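(* Let $M$ be the meromorphic function and $A_k$ the polynomials defined in the context, and let $N\in\mathbb{Z}_{\ge 0}$. Then: (0) $M(0)=A_2'(0)-A_0(0)=-\frac{13}{18}$; (1) if $N>0$, then $M(-N)=(-1)^{N-1}\,2^N\,(N-1)!\,A_{2N+2}(-N)$; (2) $$\lim_{s\to -N} M\left(s+\tfrac12\right)(s+N)=(-1)^{N-1}\,\frac{(2N)!}{2^N N!}\,\frac{A_{2N+1}\left(\frac12-N\right)}{2N-1}\sqrt{\frac{2}{\pi}} .$$
   Context: For $\Re s>1$ put $$M(s)=\sum_{n=1}^\infty \frac{e^{-n}}{n^s}\left(1+n+\frac{n^2}{2!}+\dots+\frac{n^n}{n!}\right);$$ for other $s$, $M(s)$ denotes the meromorphic continuation of this function to $\mathbb{C}$. The polynomials $A_k(s)$, $k\ge 0$, are defined by the power series expansion in $t$ $$\left[\frac{-t-\ln(1-t)}{t^2/2}\right]^s=\left[1+\frac{2t}{3}+\frac{2t^2}{4}+\frac{2t^3}{5}+\dots\right]^s=\sum_{k=0}^\infty A_k(s)\,t^k ,$$ so that $A_0(s)=1$, $A_1(s)=\frac{2s}{3}$, $A_2(s)=\frac{s(4s+5)}{18}$, and so on. *)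

theory Defs
  imports "HOL-Complex_Analysis.Complex_Analysis"
begin

section \<open>The function $M$\<close>

definition M_series :: "complex \<Rightarrow> complex" where
  "M_series s =
     (\<Sum>m. let n = Suc m in
        complex_of_real (exp (- real n)) / of_nat n powr s * (\<Sum>k\<le>n. of_nat n ^ k / fact k))"

text \<open>
  A nicely meromorphic function has no removable singularities and takes the value 0 at its poles.
  This normalisation makes the continuation unique as a total function.
\<close>
definition M :: "complex \<Rightarrow> complex" where
  "M = (THE f. f nicely_meromorphic_on UNIV \<and> (\<forall>s. Re s > 1 \<longrightarrow> f s = M_series s))"

lemma M_continuation_unique:
  assumes f: "f nicely_meromorphic_on UNIV" and fs: "\<forall>s. Re s > 1 \<longrightarrow> f s = M_series s"
    and g: "g nicely_meromorphic_on UNIV" and gs: "\<forall>s. Re s > 1 \<longrightarrow> g s = M_series s"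
  shows "f = g"
proof
  fix z
  let ?d = "\<lambda>s. f s - g s"
  have d: "?d meromorphic_on UNIV"
    using f g by (auto simp: nicely_meromorphic_on_def intro!: meromorphic_intros)
  have "eventually (\<lambda>s. s \<in> {s. Re s > 1}) (at 2)"
    by (rule eventually_at_in_open') (auto simp: open_halfspace_Re_gt)
  hence ev2: "eventually (\<lambda>s. ?d s = 0) (at 2)"
    by eventually_elim (use fs gs in auto)
  have "(\<forall>\<^sub>\<approx>x\<in>UNIV. ?d x = 0) \<or> (\<forall>\<^sub>\<approx>x\<in>UNIV. ?d x \<noteq> 0)"
    by (rule meromorphic_imp_constant_or_avoid) (use d in auto)
  moreover have "\<not> (\<forall>\<^sub>\<approx>x\<in>UNIV. ?d x \<noteq> 0)"
  proof
    assume "\<forall>\<^sub>\<approx>x\<in>UNIV. ?d x \<noteq> 0"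
    hence "eventually (\<lambda>s. ?d s \<noteq> 0) (at 2)"
      by (auto simp: eventually_cosparse_open_eq)
    with ev2 have "eventually (\<lambda>s. False) (at (2::complex))"
      by eventually_elim auto
    thus False by simp
  qed
  ultimately have "eventually (\<lambda>s. ?d s = 0) (at z)"
    by (auto simp: eventually_cosparse_open_eq)
  hence ev: "eventually (\<lambda>s. f s = g s) (at z)"
    by simp
  have pole: "is_pole f z \<longleftrightarrow> is_pole g z"
    by (rule is_pole_cong[OF ev refl])
  have lim: "f \<midarrow>z\<rightarrow> c \<longleftrightarrow> g \<midarrow>z\<rightarrow> c" for c
    by (rule tendsto_cong[OF ev])
  have "(is_pole f z \<and> f z = 0) \<or> f \<midarrow>z\<rightarrow> f z" "(is_pole g z \<and> g z = 0) \<or> g \<midarrow>z\<rightarrow> g z"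
    using f g by (auto simp: nicely_meromorphic_on_def)
  thus "f z = g z"
    using pole lim LIM_unique not_tendsto_and_filterlim_at_infinity[of "at z"]
    unfolding is_pole_def by (metis at_neq_bot)
qed

section \<open>The polynomials $A_k$\<close>

text \<open>
  The base is the formal power series $(-t-\ln(1-t))/(t^2/2)$. The series \<^term>\<open>fps_ln 1\<close>
  is that of $\ln(1+t)$.
\<close>
definition A_base :: "complex fps" where
  "A_base = (- fps_X - (fps_ln 1 oo (- fps_X))) / (fps_const (1 / 2) * fps_X ^ 2)"

text \<open>
  A formal power series $g$ with constant term 1 has the complex powers
  $g^s = \sum_j {s \choose j} (g - 1)^j$.
\<close>
definition A :: "nat \<Rightarrow> complex \<Rightarrow> complex" where
  "A k s = fps_nth (fps_binomial s oo (A_base - 1)) k"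

lemma A_base_conv_Abs_fps: "A_base = Abs_fps (\<lambda>n. 2 / (of_nat n + 2))"
proof -
  let ?B = "Abs_fps (\<lambda>n. 2 / (of_nat n + 2)) :: complex fps"
  have "- fps_X - (fps_ln 1 oo (- fps_X)) = ?B * (fps_const (1 / 2) * fps_X ^ 2)"
  proof (rule fps_ext)
    fix n
    have c: "fps_nth (fps_ln 1 oo (- fps_X)) n = (-1) ^ n * fps_nth (fps_ln 1) n" for n
      by (simp add: fps_compose_uminus')
    have r: "?B * (fps_const (1 / 2) * fps_X ^ 2) = fps_const (1 / 2) * ?B * fps_X ^ 2"
      by (simp add: mult_ac)
    show "fps_nth (- fps_X - (fps_ln 1 oo (- fps_X))) n =
          fps_nth (?B * (fps_const (1 / 2) * fps_X ^ 2)) n"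
    proof (cases "n < 2")
      case True
      thus ?thesis unfolding r
        by (auto simp: c fps_ln_nth fps_X_power_mult_right_nth less_2_cases_iff)
    next
      case False
      then obtain m where m: "n = m + 2" by (metis add.commute le_Suc_ex not_less)
      show ?thesis unfolding r
        by (simp add: m c fps_ln_nth fps_X_power_mult_right_nth add_ac
                 flip: power_add power_mult_distrib)
    qed
  qed
  moreover have "fps_const (1 / 2) * fps_X ^ 2 \<noteq> (0 :: complex fps)"
    by simp
  ultimately show ?thesis
    unfolding A_base_def by simp
qed

lemma A_0: "A 0 s = 1"
  by (simp add: A_def)

lemma A_1: "A 1 s = 2 * s / 3"
  by (simp add: A_def fps_compose_nth A_base_conv_Abs_fps)

lemma A_2: "A 2 s = s * (4 * s + 5) / 18"
  by (simp add: A_def fps_compose_nth A_base_conv_Abs_fps numeral_2_eq_2 fps_mult_nth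
      gbinomial_Suc fps_numeral_nth field_simps)

end

theory Submission
  imports Defs
begin

text \<open>
  Write $p_n = \sum_{k \le n} n^k/k!$. A finite-difference computation gives
  $\sum_n p_n (Te^{-T})^n = (1-T)^{-2}$ near $T=0$, hence on $[0,1)$ by analytic continuation. With
  $T = 1-w$ and $x = -w-\ln(1-w)$, so that $Te^{-T} = e^{-1-x}$, the Mellin integral becomes
  \[ \Gamma(s) M(s) = \int_0^\infty x^{s-1} \left(\frac{1}{w^2} - 1\right) dx
       = \int_0^1 (-w-\ln(1-w))^{s-1}\, \frac{1+w}{w}\, dw. \]
  The part of the integral away from $w=0$ is entire in $s$. On $(0,1/4]$ the integrand is
  $2^{1-s} w^{2s-3} \sum_k D_k(s) w^k$, where $D_k(s) = A_k(s-1) + A_{k-1}(s-1)$ is the $k$-th Taylor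
  coefficient of $(1+w)(x/(w^2/2))^{s-1}$. Termwise integration gives the continuation, with
  residue $2^{-s} D_k(s)$ at $s = 1-k/2$. At non-positive integers the pole is cancelled by
  $1/\Gamma(s)$. Finally $dx/dw = w/(1-w)$ yields
  $2s\,D_k(s) = (2s+k) A_k(s) - (2s+k-2) A_{k-2}(s)$, whose last term vanishes at
  $s = 1-k/2$.
\<close>

subsection \<open>The generating function of the truncated exponentials\<close>

text \<open>All poles come from the endpoint x = 0, that is w = 0. Since x behaves like w^2/2 there,
  the kernel 1/w^2 - 1 is singular in the square root of x, and this is why half-integers appear
  besides integers. In the variable w the kernel is elementary, and only the power of B(w) has to be
  expanded. The cut at w = 1/4 balances three radii. For |w| \<le> 1/2 one has |B(w) - 1| \<le> 2/3,
  so the principal branch of B(w)^(s-1) is holomorphic for |w| < 1/2. Cauchy's inequality on |w| =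
  1/3 gives D_k(s) = O(3^k), uniformly for bounded s. At w = 1/4 the expansion then converges
  geometrically with ratio 3/4. The exceptional form of M(0) also has its origin in the recurrence
  for D_k: its left-hand side vanishes at s = 0. Dividing the case k = 2 by 2s and letting s tend to
  0 gives D_2(0) = A_2'(0) - A_0(0), because A_2(0) = 0.\<close>

lemma fps_exp_minus_one_power_nth:
  assumes "i \<le> d"
  shows "fps_nth ((fps_exp 1 - 1 :: complex fps) ^ d) i = (if i = d then 1 else 0)"
proof -
  let ?U = "fps_shift 1 (fps_exp 1 - 1 :: complex fps)"
  have "fps_exp 1 - 1 = ?U * fps_X"
    by (rule fps_ext) (auto simp: fps_mult_fps_X_commute)
  hence "(fps_exp 1 - 1 :: complex fps) ^ d = ?U ^ d * fps_X ^ d"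
    by (metis power_mult_distrib)
  moreover have "fps_nth (?U ^ d) 0 = 1"
    by (simp add: fps_power_zeroth)
  ultimately show ?thesis
    using assms by (auto simp: fps_X_power_mult_right_nth)
qed

text \<open>Up to the factor d!, the sum is the coefficient of X^d in (e^X - 1)^d e^(aX). Since e^X
  - 1 starts with X, only the constant term of e^(aX) contributes, so the shift \<open>a\<close>
  drops out.\<close>

lemma finite_difference_power:
  fixes a :: complex
  shows "(\<Sum>j\<le>d. (-1) ^ (d - j) * of_nat (d choose j) * (a + of_nat j) ^ d) = fact d"
proof -
  let ?E = "fps_exp 1 :: complex fps"
  have "(\<Sum>j\<le>d. (-1) ^ (d - j) * of_nat (d choose j) * (a + of_nat j) ^ d) / fact d =
      fps_nth ((?E + (-1)) ^ d * fps_exp a) d"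
  proof -
    have "(?E + (-1)) ^ d * fps_exp a =
        (\<Sum>j\<le>d. fps_const (of_nat (d choose j) * (-1) ^ (d - j)) * fps_exp (a + of_nat j))"
      unfolding binomial_ring sum_distrib_right
      by (intro sum.cong refl)
        (simp add: fps_exp_power_mult fps_exp_add_mult mult_ac fps_of_nat flip: fps_const_mult fps_const_power fps_const_neg)
    thus ?thesis by (simp add: fps_sum_nth sum_divide_distrib mult_ac)
  qed
  also have "\<dots> = fps_nth ((?E - 1) ^ d * fps_exp a) d" by simp
  also have "\<dots> = (\<Sum>i=0..d. fps_nth ((?E - 1) ^ d) i * fps_nth (fps_exp a) (d - i))"
    by (simp add: fps_mult_nth)
  also have "\<dots> = (\<Sum>i=0..d. if i = d then 1 else 0)"
    by (intro sum.cong refl) (subst fps_exp_minus_one_power_nth, auto)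
  also have "\<dots> = 1" by simp
  finally show ?thesis by simp
qed

definition trunc_exp :: "nat \<Rightarrow> complex" where
  "trunc_exp n = (\<Sum>k\<le>n. of_nat n ^ k / fact k)"

lemma trunc_exp_conv_sum:
  "trunc_exp n = (\<Sum>i\<le>n. of_nat n ^ (n - i) / fact (n - i))"
  unfolding trunc_exp_def
  by (rule sum.reindex_bij_witness[of _ "\<lambda>i. n - i" "\<lambda>i. n - i"]) auto

text \<open>The right-hand side is the expansion of (1 - X)^(-2). With p_n written in the powers
  n^(n-i), the exponents of n in the coefficient of X^m add up to m - i, whatever n is. After the
  exchange of sums, each i \<le> m contributes a difference of order m - i of a monomial of the same
  degree, divided by (m - i)!, hence 1.\<close>

lemma trunc_exp_fps_compose:
  "Abs_fps trunc_exp oo (fps_X * fps_exp (-1)) = Abs_fps (\<lambda>m. of_nat m + 1)"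
proof (rule fps_ext)
  fix m
  have "fps_nth (Abs_fps trunc_exp oo (fps_X * fps_exp (-1))) m =
      (\<Sum>n\<le>m. trunc_exp n * ((- of_nat n) ^ (m - n) / fact (m - n)))"
    by (auto simp: fps_compose_nth power_mult_distrib fps_X_power_mult_nth fps_exp_power_mult
        atMost_atLeast0 intro!: sum.cong)
  also have "\<dots> = (\<Sum>n\<le>m. \<Sum>i\<le>n. of_nat n ^ (n - i) / fact (n - i) * ((- of_nat n) ^ (m - n) / fact (m - n)))"
    by (simp only: trunc_exp_conv_sum sum_distrib_right)
  also have "\<dots> = (\<Sum>i\<le>m. \<Sum>n=i..m. of_nat n ^ (n - i) / fact (n - i) * ((- of_nat n) ^ (m - n) / fact (m - n)))"
  proof -
    have "{i \<in> {..m}. i \<le> n} = {..n}" if "n \<le> m" for n using that by auto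
    moreover have "{n \<in> {..m}. i \<le> n} = {i..m}" for i by auto
    ultimately show ?thesis
      using sum.swap_restrict[of "{..m}" "{..m}" "\<lambda>n i. of_nat n ^ (n - i) / fact (n - i) *
          ((- of_nat n) ^ (m - n) / fact (m - n)) :: complex" "\<lambda>n i. i \<le> n"]
      by simp
  qed
  also have "\<dots> = (\<Sum>i\<le>m. 1)"
  proof (intro sum.cong refl)
    fix i assume i: "i \<in> {..m}"
    define d where "d = m - i"
    have "(\<Sum>n=i..m. of_nat n ^ (n - i) / fact (n - i) * ((- of_nat n) ^ (m - n) / fact (m - n)) :: complex) =
        (\<Sum>j\<le>d. of_nat (i + j) ^ j / fact j * ((- of_nat (i + j)) ^ (d - j) / fact (d - j)))"
      using i unfolding d_def
      by (intro sum.reindex_bij_witness[of _ "\<lambda>j. i + j" "\<lambda>n. n - i"]) auto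
    also have "\<dots> = (\<Sum>j\<le>d. (-1) ^ (d - j) * of_nat (d choose j) * (of_nat i + of_nat j) ^ d) / fact d"
      unfolding sum_divide_distrib
    proof (intro sum.cong refl)
      fix j assume j: "j \<in> {..d}"
      have "of_nat (i + j) ^ j * (- of_nat (i + j)) ^ (d - j) =
          (-1) ^ (d - j) * (of_nat i + of_nat j :: complex) ^ d"
        using j by (subst power_minus) (simp add: mult_ac flip: power_add)
      thus "of_nat (i + j) ^ j / fact j * ((- of_nat (i + j)) ^ (d - j) / fact (d - j)) =
          (-1) ^ (d - j) * of_nat (d choose j) * (of_nat i + of_nat j) ^ d / (fact d :: complex)"
        using j by (simp add: binomial_fact field_simps)
    qed
    also have "\<dots> = 1" by (simp add: finite_difference_power)
    finally show "(\<Sum>n=i..m. of_nat n ^ (n - i) / fact (n - i) * ((- of_nat n) ^ (m - n) / fact (m - n))) = (1::complex)" .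
  qed
  also have "\<dots> = of_nat m + 1" by simp
  finally show "fps_nth (Abs_fps trunc_exp oo (fps_X * fps_exp (-1))) m =
      fps_nth (Abs_fps (\<lambda>m. of_nat m + 1)) m" by simp
qed

section \<open>Convergence and analytic continuation of the generating function identity\<close>

lemma norm_trunc_exp_le: "norm (trunc_exp n) \<le> exp (real n)"
proof -
  have "norm (trunc_exp n) \<le> (\<Sum>k\<le>n. real n ^ k / fact k)"
    unfolding trunc_exp_def by (rule sum_norm_le) (simp add: norm_divide norm_power)
  also have "\<dots> \<le> (\<Sum>k. real n ^ k / fact k)"
    using summable_exp[of "real n"] by (intro sum_le_suminf) (auto simp: field_simps)
  also have "\<dots> = exp (real n)"
    by (simp add: exp_def field_simps)
  finally show ?thesis .
qed

lemma fps_conv_radius_trunc_exp: "fps_conv_radius (Abs_fps trunc_exp) \<ge> exp (-1)"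
  unfolding fps_conv_radius_def
proof (rule conv_radius_geI_ex')
  fix r :: real assume r: "0 < r" "ereal r < ereal (exp (-1))"
  show "summable (\<lambda>n. fps_nth (Abs_fps trunc_exp) n * of_real r ^ n)"
  proof (rule summable_comparison_test)
    show "\<exists>N. \<forall>n\<ge>N. norm (fps_nth (Abs_fps trunc_exp) n * of_real r ^ n) \<le> (exp 1 * r) ^ n"
    proof (intro exI[of _ 0] allI impI)
      fix n :: nat
      have "norm (trunc_exp n) * r ^ n \<le> exp (real n) * r ^ n"
        using r norm_trunc_exp_le by (intro mult_right_mono) auto
      also have "\<dots> = (exp 1 * r) ^ n"
        by (simp add: power_mult_distrib flip: exp_of_nat_mult)
      finally show "norm (fps_nth (Abs_fps trunc_exp) n * of_real r ^ n) \<le> (exp 1 * r) ^ n"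
        using r by (simp add: norm_mult norm_power)
    qed
    show "summable (\<lambda>n. (exp 1 * r) ^ n)"
      using r by (intro summable_geometric) (simp add: exp_minus field_simps)
  qed
qed

text \<open>The first hypothesis puts \<open>T * exp (- T)\<close> into the disc of radius 1/e,
  where convergence is known. The second selects the branch: a real T > 1 satisfies the first as
  well, but T e^(-T) is then also attained at some T' < 1, and the sum is 1/(1 - T')^2
  instead.\<close>

lemma sums_trunc_exp_tree:
  fixes T :: complex
  assumes "norm (T * exp (1 - T)) < 1" "norm T < 1"
  shows "(\<lambda>n. trunc_exp n * (T * exp (- T)) ^ n) sums (1 / (1 - T) ^ 2)"
proof -
  let ?F = "Abs_fps trunc_exp"
  define S where "S = {T::complex. norm (T * exp (1 - T)) < 1 \<and> norm T < 1}"
  have in_rad: "ereal (norm (T * exp (- T))) < fps_conv_radius ?F" if "T \<in> S" for T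
  proof -
    have "norm (T * exp (1 - T)) = norm (T * exp (- T)) * exp 1"
      by (simp add: norm_mult exp_diff exp_minus norm_divide norm_inverse field_simps)
    hence "norm (T * exp (- T)) < exp (-1)"
      using that by (simp add: S_def exp_minus field_simps)
    hence "ereal (norm (T * exp (- T))) < ereal (exp (-1))" by simp
    thus ?thesis using fps_conv_radius_trunc_exp by (rule less_le_trans)
  qed
  have rad0: "fps_conv_radius ?F > 0"
    using fps_conv_radius_trunc_exp exp_gt_zero[of "-1 :: real"] by (metis ereal_less(2) less_le_trans)
  have "open S"
    unfolding S_def by (intro open_Collect_conj open_Collect_less continuous_intros)
  have "0 \<in> S" by (simp add: S_def)
  text \<open>
    $S$ is star-shaped about 0 because $r \mapsto r e^{-r \Re T}$ increases on $[0,1]$ when $|T|<1$.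
  \<close>
  have "starlike S"
    unfolding starlike_def
  proof (intro bexI[of _ 0] ballI subsetI)
    fix x y assume x: "x \<in> S" and y: "y \<in> closed_segment 0 x"
    then obtain r where r: "0 \<le> r" "r \<le> 1" "y = of_real r * x"
      by (auto simp: closed_segment_def scaleR_conv_of_real)
    have Re: "Re x \<le> norm x" by (rule complex_Re_le_cmod)
    have mono: "r * exp (- (r * Re x)) \<le> 1 * exp (- Re x)"
    proof -
      \<comment> \<open>Bounding the factor r by an exponential reduces the monotonicity to a
        comparison of exponents, which uses Re x \<le> 1.\<close>
      have "r \<le> exp (r - 1)" using exp_ge_add_one_self[of "r - 1"] by simp
      moreover have "(r - 1) - r * Re x \<le> - Re x"
      proof -
        have "(1 - r) * Re x \<le> (1 - r) * 1"
          using r x Re by (intro mult_left_mono) (auto simp: S_def)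
        thus ?thesis by (simp add: algebra_simps)
      qed
      ultimately have "r * exp (- (r * Re x)) \<le> exp (r - 1) * exp (- (r * Re x))"
        by (intro mult_right_mono) auto
      also have "\<dots> = exp ((r - 1) - r * Re x)" by (simp flip: exp_add)
      also have "\<dots> \<le> exp (- Re x)" using \<open>(r - 1) - r * Re x \<le> - Re x\<close> by simp
      finally show ?thesis by simp
    qed
    have "norm (y * exp (1 - y)) = norm x * exp 1 * (r * exp (- (r * Re x)))"
    proof -
      have "norm (y * exp (1 - y)) = r * norm x * exp (1 - r * Re x)"
        using r by (simp add: norm_mult)
      also have "\<dots> = norm x * exp 1 * (r * exp (- (r * Re x)))"
        by (simp add: exp_diff exp_minus field_simps)
      finally show ?thesis .
    qed
    also have "\<dots> \<le> norm x * exp 1 * (1 * exp (- Re x))"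
      by (intro mult_left_mono mono) auto
    also have "\<dots> = norm x * exp (1 - Re x)"
      by (simp add: exp_diff exp_minus field_simps)
    also have "\<dots> = norm (x * exp (1 - x))"
      by (simp add: norm_mult)
    also have "\<dots> < 1" using x by (simp add: S_def)
    finally have "norm (y * exp (1 - y)) < 1" .
    moreover have "norm y < 1"
      using r x mult_right_mono[of r 1 "norm x"] by (auto simp: S_def norm_mult)
    ultimately show "y \<in> S" by (simp add: S_def)
  qed (use \<open>0 \<in> S\<close> in auto)
  hence "connected S" by (rule starlike_imp_connected)
  define f where "f = (\<lambda>T. eval_fps ?F (T * exp (- T)))"
  have hol: "f holomorphic_on S"
    unfolding f_def
    by (rule holomorphic_on_compose_gen[OF _ holomorphic_on_eval_fps[OF order_refl], unfolded o_def])
       (use in_rad in \<open>auto intro!: holomorphic_intros\<close>)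
  have hol': "(\<lambda>T. 1 / (1 - T) ^ 2) holomorphic_on S"
    by (intro holomorphic_intros) (auto simp: S_def)
  have e1: "f has_fps_expansion (?F oo (fps_X * fps_exp (-1)))"
  proof -
    have "(eval_fps ?F \<circ> (\<lambda>T. T * exp (- 1 * T))) has_fps_expansion (?F oo (fps_X * fps_exp (-1)))"
      by (intro has_fps_expansion_compose fps_expansion_intros eval_fps_has_fps_expansion rad0) simp
    thus ?thesis by (simp add: f_def o_def)
  qed
  have e2: "(\<lambda>T. 1 / (1 - T) ^ 2) has_fps_expansion (Abs_fps (\<lambda>m. of_nat m + 1) :: complex fps)"
  proof -
    have "(Abs_fps (\<lambda>m. of_nat m + 1) :: complex fps) = inverse ((1 - fps_X) ^ 2)"
    proof -
      have a: "inverse (1 - fps_X :: complex fps) = Abs_fps (\<lambda>n. 1)"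
        by (rule fps_inverse_unique) (simp add: fps_eq_iff ring_distribs)
      have "inverse ((1 - fps_X) ^ 2) = (Abs_fps (\<lambda>n. 1) :: complex fps) ^ 2"
        by (simp add: fps_inverse_power a)
      thus ?thesis by (simp add: fps_eq_iff power2_eq_square fps_mult_nth)
    qed
    moreover have "(\<lambda>T::complex. inverse ((1 - T) ^ 2)) has_fps_expansion inverse ((1 - fps_X) ^ 2)"
      by (intro fps_expansion_intros) auto
    ultimately show ?thesis by (simp add: inverse_eq_divide)
  qed
  have "eventually (\<lambda>T. f T = 1 / (1 - T) ^ 2) (nhds 0)"
  proof -
    let ?P = "\<lambda>f. eventually (\<lambda>z::complex. eval_fps (Abs_fps (\<lambda>m. of_nat m + 1)) z = f z) (nhds 0)"
    have "?P f" "?P (\<lambda>T. 1 / (1 - T) ^ 2)"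
      using e1 e2 unfolding trunc_exp_fps_compose has_fps_expansion_def by blast+
    thus ?thesis by eventually_elim (erule trans[OF sym], assumption)
  qed
  then obtain r where r: "r > 0" "\<forall>T\<in>ball 0 r. f T = 1 / (1 - T) ^ 2"
    unfolding eventually_nhds_metric by (auto simp: dist_commute)
  have T: "T \<in> S" using assms by (simp add: S_def)
  have fT: "f T = 1 / (1 - T) ^ 2"
  proof (rule analytic_continuation_open[of "ball 0 r \<inter> S" S f "\<lambda>T. 1 / (1 - T) ^ 2"])
    show "ball 0 r \<inter> S \<noteq> {}" using \<open>0 \<in> S\<close> r(1) by (metis IntI centre_in_ball emptyE)
    show "open (ball 0 r \<inter> S)" using \<open>open S\<close> by (intro open_Int open_ball)
    show "f z = 1 / (1 - z) ^ 2" if "z \<in> ball 0 r \<inter> S" for z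
      using r(2) that by blast
    show "open S" by fact
    show "connected S" by fact
    show "f holomorphic_on S" by fact
    show "(\<lambda>T. 1 / (1 - T) ^ 2) holomorphic_on S" by fact
    show "T \<in> S" by fact
  qed blast
  have "(\<lambda>n. fps_nth ?F n * (T * exp (- T)) ^ n) sums f T"
    unfolding f_def by (rule sums_eval_fps[OF in_rad[OF T]])
  thus ?thesis unfolding fT fps_nth_Abs_fps .
qed

subsection \<open>Powers of the base series\<close>

lemma A_base_nth: "fps_nth A_base n = 2 / (of_nat n + 2)"
  by (simp add: A_base_conv_Abs_fps)

lemma A_base_nth_0 [simp]: "fps_nth A_base 0 = 1"
  by (simp add: A_base_nth)

definition A_fps :: "complex \<Rightarrow> complex fps" where
  "A_fps s = fps_binomial s oo (A_base - 1)"

text \<open>The Taylor coefficients in $w$ of $(1+w) B(w)^{s-1}$, where $B(w) = (-w-\ln(1-w))/(w^2/2)$.\<close>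
definition D_coeff :: "nat \<Rightarrow> complex \<Rightarrow> complex" where
  "D_coeff k s = fps_nth ((1 + fps_X) * A_fps (s - 1)) k"

lemma A_fps_nth: "fps_nth (A_fps s) k = A k s"
  by (simp add: A_fps_def A_def)

text \<open>This is dx/dw = w/(1 - w) for x = (w^2/2) B(w), with the common factor w/2
  cancelled.\<close>

lemma A_base_ode: "(1 - fps_X) * (2 * A_base + fps_X * fps_deriv A_base) = 2"
proof -
  have *: "2 * A_base + fps_X * fps_deriv A_base = 2 * Abs_fps (\<lambda>n. 1)"
  proof (rule fps_ext)
    fix n
    have "(of_nat n + 2 :: complex) \<noteq> 0" by (metis of_nat_add of_nat_eq_0_iff of_nat_numeral add_2_eq_Suc' nat.simps(3))
    hence "4 / (of_nat n + 2) + of_nat n * (2 / (of_nat n + 2)) = (2 :: complex)"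
      by (simp add: divide_simps) (simp add: algebra_simps)
    thus "fps_nth (2 * A_base + fps_X * fps_deriv A_base) n = fps_nth (2 * Abs_fps (\<lambda>n. 1)) n"
      by (cases n) (simp_all add: A_base_nth fps_numeral_fps_const)
  qed
  have "(1 - fps_X) * Abs_fps (\<lambda>n. 1) = (1 :: complex fps)"
    by (rule fps_ext) (simp add: ring_distribs)
  thus ?thesis unfolding * by (simp add: mult.left_commute)
qed

lemma A_fps_minus_one: "A_fps s = A_fps (s - 1) * A_base"
proof -
  have "A_fps s = fps_binomial ((s - 1) + 1) oo (A_base - 1)"
    by (simp add: A_fps_def)
  also have "\<dots> = A_fps (s - 1) * (fps_binomial 1 oo (A_base - 1))"
    unfolding fps_binomial_add_mult A_fps_def by (rule fps_compose_mult_distrib) simp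
  also have "fps_binomial 1 oo (A_base - 1) = A_base"
    by (simp add: fps_binomial_1 fps_compose_add_distrib)
  finally show ?thesis .
qed

lemma fps_binomial_deriv': "fps_deriv (fps_binomial s) = fps_const s * fps_binomial (s - 1 :: complex)"
proof (rule fps_ext)
  fix n
  show "fps_nth (fps_deriv (fps_binomial s)) n = fps_nth (fps_const s * fps_binomial (s - 1)) n"
    using gbinomial_absorption'[of "Suc n" s] 
    by (simp add: Suc_times_gbinomial[of n "s - 1", simplified] del: of_nat_Suc)
qed

lemma A_fps_deriv: "fps_deriv (A_fps s) = fps_const s * A_fps (s - 1) * fps_deriv A_base"
proof -
  have "fps_deriv (A_fps s) = (fps_deriv (fps_binomial s) oo (A_base - 1)) * fps_deriv (A_base - 1)"
    unfolding A_fps_def by (rule fps_compose_deriv) simp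
  also have "fps_deriv (fps_binomial s) oo (A_base - 1) = fps_const s * A_fps (s - 1)"
    by (simp add: fps_binomial_deriv' fps_compose_mult_distrib A_fps_def)
  finally show ?thesis by simp
qed

text \<open>Multiply \<open>A_base_ode\<close> by s B^(s-1). The operator 2s + X d/dX on the left
  multiplies the coefficient of X^n by 2s + n, so the equation relates the coefficients for the
  exponents s and s - 1.\<close>

lemma A_fps_ode:
  "(1 - fps_X) * (fps_const (2 * s) * A_fps s + fps_X * fps_deriv (A_fps s)) = fps_const (2 * s) * A_fps (s - 1)"
proof -
  have "(1 - fps_X) * (fps_const (2 * s) * A_fps s + fps_X * fps_deriv (A_fps s)) =
      fps_const s * A_fps (s - 1) * ((1 - fps_X) * (2 * A_base + fps_X * fps_deriv A_base))"
    unfolding A_fps_deriv 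
    by (subst (1) A_fps_minus_one) (simp add: algebra_simps fps_numeral_fps_const flip: fps_const_mult)
  also have "\<dots> = fps_const (2 * s) * A_fps (s - 1)"
    unfolding A_base_ode by (simp add: algebra_simps fps_numeral_fps_const flip: fps_const_mult)
  finally show ?thesis .
qed

text \<open>The factor 1 + X in \<open>D_coeff\<close> turns 1 - X into 1 - X^2, whence the index
  step of two. Index 1 is out of range and s = 0 gives no information about \<open>D_coeff\<close>;
  both are treated by hand where they occur.\<close>

lemma D_coeff_Suc_Suc:
  "2 * s * D_coeff (Suc (Suc k)) s = (2 * s + of_nat k + 2) * A (Suc (Suc k)) s - (2 * s + of_nat k) * A k s"
proof -
  have "2 * s * D_coeff (Suc (Suc k)) s = fps_nth ((1 + fps_X) * (fps_const (2 * s) * A_fps (s - 1))) (Suc (Suc k))"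
    by (simp add: D_coeff_def ring_distribs)
  also have "\<dots> = fps_nth ((1 - fps_X ^ 2) * (fps_const (2 * s) * A_fps s + fps_X * fps_deriv (A_fps s))) (Suc (Suc k))"
    unfolding A_fps_ode[symmetric] by (simp add: algebra_simps power2_eq_square)
  also have "\<dots> = (2 * s + of_nat k + 2) * A (Suc (Suc k)) s - (2 * s + of_nat k) * A k s"
  proof -
    define F where "F = fps_const (2 * s) * A_fps s + fps_X * fps_deriv (A_fps s)"
    have F: "fps_nth F n = (2 * s + of_nat n) * A n s" for n
      by (cases n) (simp_all add: F_def A_fps_nth algebra_simps)
    have "fps_nth ((1 - fps_X ^ 2) * F) (Suc (Suc k)) = fps_nth F (Suc (Suc k)) - fps_nth F k"
      by (simp add: left_diff_distrib fps_X_power_mult_nth)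
    thus ?thesis unfolding F_def[symmetric] F by (simp add: algebra_simps)
  qed
  finally show ?thesis .
qed

lemma holomorphic_gbinomial [holomorphic_intros]:
  "(\<lambda>s. s gchoose k) holomorphic_on (U :: complex set)"
  unfolding gbinomial_prod_rev by (intro holomorphic_intros) auto

lemma holomorphic_A: "A k holomorphic_on U"
  unfolding A_def fps_compose_nth by (simp, intro holomorphic_intros)

lemma D_coeff_conv_A: "D_coeff k s = A k (s - 1) + (if k = 0 then 0 else A (k - 1) (s - 1))"
  by (simp add: D_coeff_def ring_distribs A_fps_nth)

lemma holomorphic_D_coeff: "D_coeff k holomorphic_on U"
proof -
  have "(\<lambda>s. A k (s - 1)) holomorphic_on U" for k
    using holomorphic_on_compose[OF _ holomorphic_A, of "\<lambda>s. s - 1" U k]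
    by (simp add: o_def holomorphic_on_diff)
  thus ?thesis by (cases "k = 0") (simp_all add: D_coeff_conv_A[abs_def] holomorphic_on_add)
qed

section \<open>The base series as an analytic function, and bounds for the coefficients
  D_k(s)\<close>

definition A_base_eval :: "complex \<Rightarrow> complex" where
  "A_base_eval = eval_fps A_base"

lemma fps_conv_radius_A_base: "fps_conv_radius A_base \<ge> 1"
  unfolding fps_conv_radius_def
proof (rule conv_radius_geI_ex')
  fix r :: real assume r: "0 < r" "ereal r < 1"
  show "summable (\<lambda>n. fps_nth A_base n * of_real r ^ n)"
  proof (rule summable_comparison_test)
    show "\<exists>N. \<forall>n\<ge>N. norm (fps_nth A_base n * of_real r ^ n) \<le> r ^ n"
    proof (intro exI[of _ 0] allI impI)
      fix n :: nat
      have "norm (fps_nth A_base n) = 2 / (real n + 2)"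
        using norm_of_nat[of "n + 2", where ?'a = complex] by (simp add: A_base_nth norm_divide add_ac)
      hence "norm (fps_nth A_base n) \<le> 1" by simp
      thus "norm (fps_nth A_base n * of_real r ^ n) \<le> r ^ n"
        using r mult_right_mono[of "norm (fps_nth A_base n)" 1 "r ^ n"] by (simp add: norm_mult norm_power)
    qed
    show "summable (\<lambda>n. r ^ n)"
      using r by (intro summable_geometric) simp
  qed
qed

lemma A_base_eval_sums: "norm w < 1 \<Longrightarrow> (\<lambda>n. 2 / (of_nat n + 2) * w ^ n) sums A_base_eval w"
  using sums_eval_fps[of w A_base] fps_conv_radius_A_base
  unfolding A_base_eval_def A_base_nth by (meson ereal_less(3) less_le_trans)

text \<open>The logarithm series without its linear term. The form multiplied by w^2/2 stays
  meaningful at w = 0, where the quotient would be 0/0.\<close>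

lemma A_base_eval_eq:
  assumes "norm w < 1"
  shows "w ^ 2 / 2 * A_base_eval w = - w - ln (1 - w)"
proof -
  have "(\<lambda>n. - (w ^ n) / of_nat n) sums ln (1 - w)"
    using Ln_series'[of "- w"] assms by simp
  hence "(\<lambda>n. w ^ n / of_nat n) sums (- ln (1 - w))"
    using sums_minus by fastforce
  hence "(\<lambda>n. w ^ (n + 2) / of_nat (n + 2)) sums (- ln (1 - w) - (\<Sum>n<2. w ^ n / of_nat n))"
    by (subst sums_iff_shift) simp
  \<comment> \<open>The summand at n = 0 is 1/0 = 0, so only the linear term is split off.\<close>
  moreover have "(\<Sum>n<2. w ^ n / of_nat n) = w"
    by (simp add: numeral_2_eq_2)
  ultimately have "(\<lambda>n. w ^ (n + 2) / of_nat (n + 2)) sums (- w - ln (1 - w))"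
    by (simp only: diff_conv_add_uminus add.commute)
  moreover have "(\<lambda>n. w ^ 2 / 2 * (2 / (of_nat n + 2) * w ^ n)) sums (w ^ 2 / 2 * A_base_eval w)"
    by (intro sums_mult A_base_eval_sums assms)
  hence "(\<lambda>n. w ^ (n + 2) / of_nat (n + 2)) sums (w ^ 2 / 2 * A_base_eval w)"
    by (simp add: power_add power2_eq_square mult_ac add_ac)
  ultimately show ?thesis by (rule sums_unique2[symmetric])
qed

text \<open>Each coefficient after the constant one is at most 2/3, and 2^(-n) sums to 1 over n
  \<ge> 1. A bound below 1 keeps B in the right half-plane, away from the cut of the principal
  logarithm.\<close>

lemma norm_A_base_eval_sub_one_le:
  assumes "norm w \<le> 1 / 2"
  shows "norm (A_base_eval w - 1) \<le> 2 / 3"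
proof -
  have "(\<lambda>n. 2 / (of_nat (Suc n) + 2) * w ^ Suc n) sums (A_base_eval w - 1)"
    using sums_Suc_iff[of "\<lambda>n. 2 / (of_nat n + 2) * w ^ n" "A_base_eval w - 1"] A_base_eval_sums[of w] assms by simp
  moreover have "norm (2 / (of_nat (Suc n) + 2) * w ^ Suc n) \<le> 1 / 3 * (1 / 2) ^ n" for n
  proof -
    have "norm (2 / (of_nat (Suc n) + 2) * w ^ Suc n) = 2 / (real n + 3) * norm w ^ Suc n"
      using norm_of_nat[of "n + 3", where ?'a = complex] by (simp add: norm_mult norm_divide norm_power add_ac)
    also have "\<dots> \<le> 2 / 3 * (1 / 2) ^ Suc n"
      using assms by (intro mult_mono power_mono) (auto simp: field_simps)
    finally show ?thesis by simp
  qed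
  moreover have "(\<lambda>n. 1 / 3 * (1 / 2) ^ n) sums (1 / 3 * (1 / (1 - 1 / 2 :: real)))"
    by (intro sums_mult geometric_sums) auto
  ultimately show ?thesis
    using norm_suminf_le[of "\<lambda>n. 2 / (of_nat (Suc n) + 2) * w ^ Suc n" "\<lambda>n. 1 / 3 * (1 / 2) ^ n"]
    by (simp add: sums_iff)
qed

lemma Re_A_base_eval_pos: "norm w \<le> 1 / 2 \<Longrightarrow> Re (A_base_eval w) > 0"
  using norm_A_base_eval_sub_one_le[of w] abs_Re_le_cmod[of "A_base_eval w - 1"] by auto

lemma A_base_eval_not_nonpos: "norm w \<le> 1 / 2 \<Longrightarrow> A_base_eval w \<notin> \<real>\<^sub>\<le>\<^sub>0"
  using Re_A_base_eval_pos[of w] by (auto simp: complex_nonpos_Reals_iff)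

lemma holomorphic_A_base_eval: "A_base_eval holomorphic_on ball 0 1"
  unfolding A_base_eval_def using fps_conv_radius_A_base
  by (intro holomorphic_on_eval_fps) (auto simp: subset_iff intro: less_le_trans[of _ 1])

text \<open>Ties the formal power, built from binomial coefficients, to the principal branch; they
  match because B(0) = 1.\<close>

lemma A_base_eval_powr_has_fps_expansion: "(\<lambda>w. A_base_eval w powr s) has_fps_expansion A_fps s"
proof -
  have "fps_conv_radius A_base > 0"
    using fps_conv_radius_A_base by (rule less_le_trans[rotated]) simp
  hence "((\<lambda>x. (1 + x) powr s) \<circ> (\<lambda>w. A_base_eval w - 1)) has_fps_expansion A_fps s"
    unfolding A_fps_def A_base_eval_def
    by (intro has_fps_expansion_compose fps_expansion_intros eval_fps_has_fps_expansion) auto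
  thus ?thesis by (simp add: o_def)
qed

lemma holomorphic_A_base_eval_powr: "(\<lambda>w. A_base_eval w powr s) holomorphic_on ball 0 (1 / 2)"
proof (intro holomorphic_intros)
  show "A_base_eval holomorphic_on ball 0 (1 / 2)"
    by (rule holomorphic_on_subset[OF holomorphic_A_base_eval]) auto
qed (auto intro!: A_base_eval_not_nonpos)

lemma D_coeff_sums:
  assumes "norm w < 1 / 2"
  shows "(\<lambda>k. D_coeff k s * w ^ k) sums ((1 + w) * A_base_eval w powr (s - 1))"
  unfolding D_coeff_def
proof (rule has_fps_expansion_imp_sums_complex[where r = "ereal (1 / 2)"])
  show "(\<lambda>w. (1 + w) * A_base_eval w powr (s - 1)) has_fps_expansion (1 + fps_X) * A_fps (s - 1)"
    by (intro fps_expansion_intros A_base_eval_powr_has_fps_expansion)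
  show "(\<lambda>w. (1 + w) * A_base_eval w powr (s - 1)) holomorphic_on eball 0 (ereal (1 / 2))"
    by (auto intro!: holomorphic_intros holomorphic_A_base_eval_powr)
qed (use assms in auto)

text \<open>Cauchy's inequality on |w| = 1/3, with the function of both variables bounded on a
  compact product of discs. Uniformity in s is what allows the head series to be summed as a series
  of holomorphic functions.\<close>

lemma norm_D_coeff_le:
  obtains C where "C > 0" "\<And>k s. norm s \<le> R \<Longrightarrow> norm (D_coeff k s) \<le> C * 3 ^ k"
proof -
  define f where "f = (\<lambda>s w. (1 + w) * A_base_eval w powr (s - 1))"
  define K where "K = cball (0 :: complex) R \<times> cball (0 :: complex) (1 / 3)"
  have contB: "continuous_on (cball 0 (1 / 3)) A_base_eval"
    by (rule holomorphic_on_imp_continuous_on, rule holomorphic_on_subset[OF holomorphic_A_base_eval]) auto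
  have pos: "0 < Re (A_base_eval w)" if "norm w * 3 \<le> 1" for w
    by (rule Re_A_base_eval_pos) (use that norm_ge_zero[of w] in linarith)
  have "continuous_on K (\<lambda>(s, w). f s w)"
    unfolding f_def K_def case_prod_unfold
    by (intro continuous_intros continuous_on_compose2[OF contB])
       (auto dest!: pos)
  hence "bounded ((\<lambda>(s, w). f s w) ` K)"
    by (intro compact_imp_bounded compact_continuous_image) (auto simp: K_def intro: compact_Times)
  then obtain C where "C > 0" "\<forall>y\<in>(\<lambda>(s, w). f s w) ` K. norm y \<le> C"
    unfolding bounded_pos by blast
  hence C: "norm (f s w) \<le> C" if "s \<in> cball 0 R" "w \<in> cball 0 (1 / 3)" for s w
    using that unfolding K_def by blast
  show ?thesis
  proof (rule that[of C])
    fix k s assume s: "norm (s :: complex) \<le> R"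
    have fps: "f s has_fps_expansion (1 + fps_X) * A_fps (s - 1)"
      unfolding f_def by (intro fps_expansion_intros A_base_eval_powr_has_fps_expansion)
    have hol: "f s holomorphic_on ball 0 (1 / 2)"
      unfolding f_def by (intro holomorphic_intros holomorphic_A_base_eval_powr)
    have "norm ((deriv ^^ k) (f s) 0) \<le> fact k * C / (1 / 3) ^ k"
      using s \<open>C > 0\<close> C
      by (intro Cauchy_inequality holomorphic_on_imp_continuous_on holomorphic_on_subset[OF hol]) auto
    thus "norm (D_coeff k s) \<le> C * 3 ^ k"
      unfolding D_coeff_def fps_nth_fps_expansion[OF fps] by (simp add: norm_divide field_simps)
  qed (use \<open>C > 0\<close> in auto)
qed

subsection \<open>The Mellin transform of the generating function\<close>

lemma holomorphic_on_lebesgue_integral: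
  fixes f :: "complex \<Rightarrow> 'a \<Rightarrow> complex"
  assumes "open U"
    and hol: "\<And>x. x \<in> space Q \<Longrightarrow> (\<lambda>s. f s x) holomorphic_on U"
    and meas: "\<And>s. s \<in> U \<Longrightarrow> f s \<in> borel_measurable Q"
    and dom: "\<And>s. s \<in> U \<Longrightarrow> \<exists>r>0. \<exists>g. cball s r \<subseteq> U \<and> integrable Q g \<and>
                (\<forall>t\<in>cball s r. \<forall>x\<in>space Q. norm (f t x) \<le> g x)"
  shows "(\<lambda>s. \<integral>x. f s x \<partial>Q) holomorphic_on U"
proof (rule holomorphic_onI)
  fix s assume s: "s \<in> U"
  text \<open>Cauchy's inequality on discs of radius $r/2$ dominates the difference quotients by $2g/r$.\<close>
  obtain r g where r: "r > 0" "cball s r \<subseteq> U" and g: "integrable Q g"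
    and le: "\<And>t x. t \<in> cball s r \<Longrightarrow> x \<in> space Q \<Longrightarrow> norm (f t x) \<le> g x"
    using dom[OF s] by blast
  have int: "integrable Q (f t)" if "t \<in> cball s r" for t
    using that r le by (intro Bochner_Integration.integrable_bound[OF g] meas) (auto intro!: order_trans[OF le])
  have s_in: "s \<in> cball s r" using r by simp
  define f' where "f' = (\<lambda>x. deriv (\<lambda>s. f s x) s)"
  have quot_le: "norm ((f t x - f s x) / (t - s)) \<le> 2 / r * g x"
    if t: "t \<in> ball s (r / 2) - {s}" and x: "x \<in> space Q" for t x
  proof -
    have "norm (f t x - f s x) \<le> (g x / (r / 2)) * norm (t - s)"
    proof (rule field_differentiable_bound[of "ball s (r / 2)" "\<lambda>s. f s x" "\<lambda>u. deriv (\<lambda>s. f s x) u"])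
      fix u assume u: "u \<in> ball s (r / 2)"
      have sub: "cball u (r / 2) \<subseteq> cball s r"
      proof
        fix v assume "v \<in> cball u (r / 2)"
        thus "v \<in> cball s r" using u dist_triangle[of s v u] by (auto simp: dist_commute)
      qed
      have hU: "(\<lambda>s. f s x) holomorphic_on cball u (r / 2)"
        using hol[OF x] sub r(2) by (blast intro: holomorphic_on_subset)
      have "u \<in> U" using u r by (auto simp: subset_iff)
      thus "((\<lambda>s. f s x) has_field_derivative deriv (\<lambda>s. f s x) u) (at u within ball s (r / 2))"
        using holomorphic_derivI[OF hol[OF x] \<open>open U\<close>] by blast
      have "norm ((deriv ^^ 1) (\<lambda>s. f s x) u) \<le> fact 1 * g x / (r / 2) ^ 1"
      proof (rule Cauchy_inequality)
        fix v assume "norm (u - v) = r / 2"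
        hence "v \<in> cball u (r / 2)" by (simp add: dist_norm)
        thus "norm (f v x) \<le> g x" using le[of v x] x sub by blast
      qed (use r hU in \<open>auto intro: holomorphic_on_imp_continuous_on holomorphic_on_subset\<close>)
      thus "norm (deriv (\<lambda>s. f s x) u) \<le> g x / (r / 2)" by simp
    qed (use t r in auto)
    thus ?thesis using t r by (simp add: norm_divide field_simps)
  qed
  have lim: "((\<lambda>t. (f t x - f s x) / (t - s)) \<longlongrightarrow> f' x) (at s)" if x: "x \<in> space Q" for x
    using holomorphic_derivI[OF hol[OF x] \<open>open U\<close> s, of UNIV]
    unfolding f'_def has_field_derivative_iff by simp
  \<comment> \<open>The derivative is a pointwise limit of measurable difference quotients along
    \<open>h\<close>. The offset 2 in the denominator keeps every \<open>h n\<close> strictly within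
    distance r/2 of s.\<close>
  have meas': "f' \<in> borel_measurable Q"
  proof (rule borel_measurable_LIMSEQ_metric)
    define h where "h = (\<lambda>n. s + of_real (r / 2 / of_nat (n + 2)))"
    have h: "h n \<in> ball s (r / 2) - {s}" for n
      using r by (auto simp: h_def dist_norm norm_divide field_simps simp flip: of_nat_Suc)
    have hs: "h \<longlonglongrightarrow> s"
    proof -
      have "(\<lambda>n. r / 2 / of_nat (n + 2)) \<longlonglongrightarrow> 0"
        by real_asymp
      hence "(\<lambda>n. s + of_real (r / 2 / of_nat (n + 2))) \<longlonglongrightarrow> s + of_real 0"
        by (intro tendsto_intros)
      thus ?thesis by (simp add: h_def)
    qed
    show "(\<lambda>x. (f (h n) x - f s x) / (h n - s)) \<in> borel_measurable Q" for n
    proof -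
      have "h n \<in> U" using h[of n] r by (auto simp: subset_iff)
      thus ?thesis using s meas by (intro borel_measurable_divide borel_measurable_diff) auto
    qed
    show "(\<lambda>n. (f (h n) x - f s x) / (h n - s)) \<longlonglongrightarrow> f' x" if "x \<in> space Q" for x
      using lim[OF that] hs h unfolding tendsto_at_iff_sequentially o_def by auto
  qed
  have "((\<lambda>t. ((\<integral>x. f t x \<partial>Q) - (\<integral>x. f s x \<partial>Q)) / (t - s)) \<longlongrightarrow> (\<integral>x. f' x \<partial>Q)) (at s)"
    unfolding tendsto_at_iff_sequentially o_def
  proof (intro allI impI)
    fix h :: "nat \<Rightarrow> complex" assume h: "\<forall>i. h i \<in> UNIV - {s}" "h \<longlonglongrightarrow> s"
    have "eventually (\<lambda>n. h n \<in> ball s (r / 2)) sequentially"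
      using h(2) r by (intro topological_tendstoD[OF h(2)]) auto
    then obtain N where "\<And>n. n \<ge> N \<Longrightarrow> h n \<in> ball s (r / 2)"
      unfolding eventually_sequentially by blast
    hence N: "h (n + N) \<in> ball s (r / 2) - {s}" for n
      using h(1) by auto
    have hN: "(\<lambda>n. h (n + N)) \<longlonglongrightarrow> s" using h(2) by (rule LIMSEQ_ignore_initial_segment)
    have inU: "h (n + N) \<in> cball s r" "h (n + N) \<in> U" for n
      using N[of n] r by (auto simp: subset_iff)
    have "(\<lambda>n. \<integral>x. (f (h (n + N)) x - f s x) / (h (n + N) - s) \<partial>Q) \<longlonglongrightarrow> (\<integral>x. f' x \<partial>Q)"
    proof (rule integral_dominated_convergence[where w = "\<lambda>x. 2 / r * g x"])
      show "AE x in Q. (\<lambda>n. (f (h (n + N)) x - f s x) / (h (n + N) - s)) \<longlonglongrightarrow> f' x"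
      proof (rule AE_I2)
        fix x assume "x \<in> space Q"
        from lim[OF this] show "(\<lambda>n. (f (h (n + N)) x - f s x) / (h (n + N) - s)) \<longlonglongrightarrow> f' x"
          using hN h(1) unfolding tendsto_at_iff_sequentially o_def by auto
      qed
      show "AE x in Q. norm ((f (h (n + N)) x - f s x) / (h (n + N) - s)) \<le> 2 / r * g x" for n
        by (intro AE_I2 quot_le N)
      show "(\<lambda>x. (f (h (n + N)) x - f s x) / (h (n + N) - s)) \<in> borel_measurable Q" for n
        by (intro borel_measurable_divide borel_measurable_diff borel_measurable_const meas inU s)
      show "integrable Q (\<lambda>x. 2 / r * g x)"
        by (intro integrable_mult_right g)
    qed (fact meas')
    moreover have "(\<integral>x. (f (h (n + N)) x - f s x) / (h (n + N) - s) \<partial>Q) =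
        ((\<integral>x. f (h (n + N)) x \<partial>Q) - (\<integral>x. f s x \<partial>Q)) / (h (n + N) - s)" for n
      using Bochner_Integration.integral_diff[OF int[OF inU(1)] int[OF s_in]]
      unfolding integral_divide_zero by metis
    ultimately have "(\<lambda>n. ((\<integral>x. f (h (n + N)) x \<partial>Q) - (\<integral>x. f s x \<partial>Q)) / (h (n + N) - s)) \<longlonglongrightarrow> (\<integral>x. f' x \<partial>Q)"
      by (simp only:)
    thus "(\<lambda>n. ((\<integral>x. f (h n) x \<partial>Q) - (\<integral>x. f s x \<partial>Q)) / (h n - s)) \<longlonglongrightarrow> (\<integral>x. f' x \<partial>Q)"
      by (rule LIMSEQ_offset)
  qed
  hence "((\<lambda>s. \<integral>x. f s x \<partial>Q) has_field_derivative (\<integral>x. f' x \<partial>Q)) (at s)"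
    by (simp add: has_field_derivative_iff)
  thus "(\<lambda>s. \<integral>x. f s x \<partial>Q) field_differentiable at s within U"
    using field_differentiable_at_within field_differentiable_def by blast
qed

section \<open>Gamma integrals and the Mellin transform for Re s > 1\<close>

lemma set_borel_measurable_powr:
  "S \<in> sets borel \<Longrightarrow> S \<subseteq> {0<..} \<Longrightarrow> (\<lambda>x. indicator S x *\<^sub>R (complex_of_real x powr s)) \<in> borel_measurable borel"
  by (intro borel_measurable_continuous_on_indicator continuous_intros) (auto simp: complex_nonpos_Reals_iff)

text \<open>The Gamma integral transferred from Lebesgue measure to \<open>lborel\<close>; the
  transfer of integrability rests on Borel measurability of the integrand.\<close>

lemma Gamma_integral_lborel:
  assumes "Re s > 0"
  shows "set_integrable lborel {0<..} (\<lambda>x. complex_of_real x powr (s - 1) * of_real (exp (- x)))"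
    and "(LINT x:{0<..}|lborel. complex_of_real x powr (s - 1) * of_real (exp (- x))) = Gamma s"
proof -
  have eq: "complex_of_real t powr (s - 1) / of_real (exp t) = of_real t powr (s - 1) * of_real (exp (- t))" for t
    by (simp add: exp_minus field_simps)
  have "(\<lambda>x. indicator {0<..} x *\<^sub>R (complex_of_real x powr (s - 1) * of_real (exp (- x)))) \<in> borel_measurable borel"
    by (intro borel_measurable_continuous_on_indicator continuous_intros) (auto simp: complex_nonpos_Reals_iff)
  thus i: "set_integrable lborel {0<..} (\<lambda>x. complex_of_real x powr (s - 1) * of_real (exp (- x)))"
    using absolutely_integrable_Gamma_integral'[OF assms] 
    unfolding set_integrable_def eq by (subst (asm) integrable_completion) auto
  show "(LINT x:{0<..}|lborel. complex_of_real x powr (s - 1) * of_real (exp (- x))) = Gamma s"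
    using Gamma_integral_complex'[OF assms] set_borel_integral_eq_integral(2)[OF i]
    unfolding eq by (simp add: integral_unique)
qed

text \<open>Substitute a x for x. The third identity displays the L1 norm as a constant times a^(-Re
  s); taken at a = n it yields the summable majorant for exchanging sum and integral.\<close>

lemma Gamma_integral_scaled:
  assumes "Re s > 0" "a > 0"
  shows "set_integrable lborel {0<..} (\<lambda>x. complex_of_real x powr (s - 1) * of_real (exp (- (a * x))))"
    and "(LINT x:{0<..}|lborel. complex_of_real x powr (s - 1) * of_real (exp (- (a * x)))) =
           Gamma s / of_real a powr s"
    and "(LINT x:{0<..}|lborel. norm (complex_of_real x powr (s - 1) * of_real (exp (- (a * x))))) =
           (LINT x:{0<..}|lborel. norm (complex_of_real x powr (s - 1) * of_real (exp (- x)))) / a powr Re s"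
proof -
  define h where "h = (\<lambda>x. indicator {0<..} x *\<^sub>R (complex_of_real x powr (s - 1) * of_real (exp (- x))))"
  define k where "k = (\<lambda>x. indicator {0<..} x *\<^sub>R (complex_of_real x powr (s - 1) * of_real (exp (- (a * x)))))"
  define c where "c = complex_of_real a powr (s - 1)"
  have c: "c \<noteq> 0" using assms by (simp add: c_def)
  have norm_c: "norm c = a powr (Re s - 1)"
    using assms by (simp add: c_def norm_powr_real_powr)
  have h: "integrable lborel h" "integral\<^sup>L lborel h = Gamma s"
    using Gamma_integral_lborel[OF assms(1)] by (simp_all add: h_def set_integrable_def set_lebesgue_integral_def)
  have hk: "h (0 + a * x) = c * k x" for x
    using assms by (auto simp: h_def k_def c_def indicator_def powr_times_real zero_less_mult_iff)
  have "integrable lborel (\<lambda>x. c * k x)"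
    using lborel_integrable_real_affine[OF h(1), of a 0] assms unfolding hk by simp
  hence "integrable lborel (\<lambda>x. inverse c * (c * k x))"
    by (rule integrable_mult_right)
  moreover have "(\<lambda>x. inverse c * (c * k x)) = k"
    using c by (simp add: fun_eq_iff field_simps)
  ultimately have "integrable lborel k" by (simp only:)
  thus "set_integrable lborel {0<..} (\<lambda>x. complex_of_real x powr (s - 1) * of_real (exp (- (a * x))))"
    by (simp add: set_integrable_def k_def)
  have "Gamma s = of_real a * (c * integral\<^sup>L lborel k)"
    using lborel_integral_real_affine[of a h 0] assms h unfolding hk by (simp add: scaleR_conv_of_real)
  also have "of_real a * c = of_real a powr s"
    using assms by (simp add: c_def powr_diff)
  hence "of_real a * (c * integral\<^sup>L lborel k) = of_real a powr s * integral\<^sup>L lborel k"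
    by (simp add: mult.assoc[symmetric])
  finally show "(LINT x:{0<..}|lborel. complex_of_real x powr (s - 1) * of_real (exp (- (a * x)))) =
           Gamma s / of_real a powr s"
    using assms by (simp add: k_def set_lebesgue_integral_def field_simps)
  have "(\<integral>x. norm (h x) \<partial>lborel) = a * (norm c * (\<integral>x. norm (k x) \<partial>lborel))"
    using lborel_integral_real_affine[of a "\<lambda>x. norm (h x)" 0] assms unfolding hk by (simp add: norm_mult)
  also have "\<dots> = a powr Re s * (\<integral>x. norm (k x) \<partial>lborel)"
    using assms by (simp add: norm_c powr_diff)
  finally show "(LINT x:{0<..}|lborel. norm (complex_of_real x powr (s - 1) * of_real (exp (- (a * x))))) =
           (LINT x:{0<..}|lborel. norm (complex_of_real x powr (s - 1) * of_real (exp (- x)))) / a powr Re s"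
    using assms by (simp add: h_def k_def set_lebesgue_integral_def field_simps)
qed

text \<open>The kernel whose Mellin transform is Gamma(s) times the series for M(s). As in that
  series the index starts at n = 1; the missing term p_0 = 1 is the source of the -1 in 1/w^2 -
  1.\<close>

definition trunc_exp_gf :: "real \<Rightarrow> complex" where
  "trunc_exp_gf x = (\<Sum>m. trunc_exp (Suc m) * of_real (exp (- real (Suc m))) * of_real (exp (- (real (Suc m) * x))))"

lemma norm_scaled_trunc_exp_le: "norm (trunc_exp n * of_real (exp (- real n))) \<le> 1"
  using mult_right_mono[OF norm_trunc_exp_le[of n], of "exp (- real n)"]
  by (simp add: norm_mult mult_exp_exp)

lemma summable_trunc_exp_gf:
  assumes "x > 0"
  shows "summable (\<lambda>m. norm (trunc_exp (Suc m) * of_real (exp (- real (Suc m))) * of_real (exp (- (real (Suc m) * x)))))"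
proof (rule summable_comparison_test)
  show "\<exists>N. \<forall>m\<ge>N. norm (norm (trunc_exp (Suc m) * of_real (exp (- real (Suc m))) * of_real (exp (- (real (Suc m) * x)))))
      \<le> exp (- x) ^ Suc m"
  proof (intro exI[of _ 0] allI impI)
    fix m :: nat
    have "exp (- (real (Suc m) * x)) = exp (- x) ^ Suc m"
      by (subst exp_of_nat_mult[symmetric]) simp
    thus "norm (norm (trunc_exp (Suc m) * of_real (exp (- real (Suc m))) * of_real (exp (- (real (Suc m) * x)))))
      \<le> exp (- x) ^ Suc m"
      using mult_right_mono[OF norm_scaled_trunc_exp_le[of "Suc m"], of "exp (- x) ^ Suc m"]
      unfolding norm_mult[of _ "of_real (exp (- (real (Suc m) * x)))"] norm_of_real by simp
  qed
  show "summable (\<lambda>m. exp (- x) ^ Suc m)"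
    using assms by (subst summable_Suc_iff) (auto intro: summable_geometric)
qed

text \<open>Termwise integration: since p_n e^(-n) \<le> 1, the L1 norms of the terms are at most a
  multiple of n^(-Re s), which is summable for Re s > 1.\<close>

lemma Mellin_trunc_exp_gf:
  assumes s: "Re s > 1"
  shows "set_integrable lborel {0<..} (\<lambda>x. complex_of_real x powr (s - 1) * trunc_exp_gf x)"
    and "(LINT x:{0<..}|lborel. complex_of_real x powr (s - 1) * trunc_exp_gf x) = Gamma s * M_series s"
proof -
  define c where "c = (\<lambda>m. trunc_exp (Suc m) * complex_of_real (exp (- real (Suc m))))"
  define k where "k = (\<lambda>m x. complex_of_real x powr (s - 1) * of_real (exp (- (real (Suc m) * x))))"
  define K where "K = (LINT x:{0<..}|lborel. norm (complex_of_real x powr (s - 1) * of_real (exp (- x))))"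
  define f where "f = (\<lambda>m x. indicator {0<..} x *\<^sub>R (c m * k m x))"
  have c: "norm (c m) \<le> 1" for m unfolding c_def by (rule norm_scaled_trunc_exp_le)
  have k: "integrable lborel (\<lambda>x. indicator {0<..} x *\<^sub>R k m x)" for m
    using Gamma_integral_scaled(1)[of s "real (Suc m)"] s unfolding k_def set_integrable_def by simp
  have f_eq: "f m = (\<lambda>x. c m * (indicator {0<..} x *\<^sub>R k m x))" for m
    by (simp add: f_def fun_eq_iff)
  have int: "integrable lborel (f m)" for m
    unfolding f_eq by (intro integrable_mult_right k)
  have int_k: "(\<integral>x. indicator {0<..} x *\<^sub>R k m x \<partial>lborel) = Gamma s / of_nat (Suc m) powr s"
    and int_norm_k: "(\<integral>x. norm (indicator {0<..} x *\<^sub>R k m x) \<partial>lborel) = K / real (Suc m) powr Re s" for m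
    using Gamma_integral_scaled(2,3)[of s "real (Suc m)"] s
    unfolding k_def K_def set_lebesgue_integral_def by (simp_all del: of_nat_Suc)
  have int_f: "integral\<^sup>L lborel (f m) = Gamma s * (c m / of_nat (Suc m) powr s)" for m
    unfolding f_eq integral_mult_right_zero int_k by simp
  have int_norm: "(\<integral>x. norm (f m x) \<partial>lborel) = norm (c m) * (K / real (Suc m) powr Re s)" for m
    unfolding f_eq norm_mult integral_mult_right_zero int_norm_k ..
  have K: "K \<ge> 0" unfolding K_def set_lebesgue_integral_def by (intro integral_nonneg_AE) auto
  have sum_norm: "summable (\<lambda>m. norm (f m x))" for x
  proof (cases "x > 0")
    case True
    have "norm (f m x) = norm (complex_of_real x powr (s - 1)) *
      norm (trunc_exp (Suc m) * of_real (exp (- real (Suc m))) * of_real (exp (- (real (Suc m) * x))))" for m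
      using True by (simp add: f_def c_def k_def norm_mult)
    thus ?thesis using summable_mult[OF summable_trunc_exp_gf[OF True]] by simp
  qed (simp add: f_def)
  have sum_int: "summable (\<lambda>m. \<integral>x. norm (f m x) \<partial>lborel)"
  proof (rule summable_comparison_test)
    show "\<exists>N. \<forall>m\<ge>N. norm (\<integral>x. norm (f m x) \<partial>lborel) \<le> K * real (Suc m) powr (- Re s)"
    proof (intro exI[of _ 0] allI impI)
      fix m
      show "norm (\<integral>x. norm (f m x) \<partial>lborel) \<le> K * real (Suc m) powr (- Re s)"
        unfolding int_norm using K mult_right_mono[OF c[of m], of "K / real (Suc m) powr Re s"]
        by (simp add: powr_minus_divide abs_mult del: of_nat_Suc)
    qed
    show "summable (\<lambda>m. K * real (Suc m) powr (- Re s))"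
      using s by (intro summable_mult) (subst summable_Suc_iff, simp add: summable_real_powr_iff)
  qed
  have lim: "(\<Sum>m. f m x) = indicator {0<..} x *\<^sub>R (complex_of_real x powr (s - 1) * trunc_exp_gf x)" for x
  proof (cases "x > 0")
    case True
    have "f m x = complex_of_real x powr (s - 1) *
      (trunc_exp (Suc m) * of_real (exp (- real (Suc m))) * of_real (exp (- (real (Suc m) * x))))" for m
      using True by (simp add: f_def c_def k_def)
    thus ?thesis using True suminf_mult[OF summable_norm_cancel[OF summable_trunc_exp_gf[OF True]]]
      by (simp add: trunc_exp_gf_def)
  qed (simp add: f_def)
  show "set_integrable lborel {0<..} (\<lambda>x. complex_of_real x powr (s - 1) * trunc_exp_gf x)"
    using integrable_suminf[OF int _ sum_int] sum_norm unfolding lim set_integrable_def by simp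
  have "(\<lambda>m. integral\<^sup>L lborel (f m)) sums (LINT x:{0<..}|lborel. complex_of_real x powr (s - 1) * trunc_exp_gf x)"
    using sums_integral[OF int _ sum_int] sum_norm unfolding lim set_lebesgue_integral_def by simp
  hence "(\<lambda>m. Gamma s * (c m / of_nat (Suc m) powr s)) sums (LINT x:{0<..}|lborel. complex_of_real x powr (s - 1) * trunc_exp_gf x)"
    unfolding int_f .
  moreover have "M_series s = (\<Sum>m. c m / of_nat (Suc m) powr s)"
    unfolding M_series_def Let_def c_def trunc_exp_def by (simp add: mult_ac)
  \<comment> \<open>Every termwise integral carries the factor Gamma(s); cancelling it transfers
    convergence to the series for M.\<close>
  moreover have "Gamma s \<noteq> 0" 
    using s by (auto simp: Gamma_eq_zero_iff elim!: nonpos_Ints_cases')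
  ultimately show "(LINT x:{0<..}|lborel. complex_of_real x powr (s - 1) * trunc_exp_gf x) = Gamma s * M_series s"
    using sums_mult_D[of "Gamma s" "\<lambda>m. c m / of_nat (Suc m) powr s"] 
    by (simp add: sums_iff suminf_mult)
qed

text \<open>No decay estimate for the kernel enters. The Mellin integral converges absolutely at
  every real exponent b > 1, and away from x = 0 a large b majorises the integrands for all s near a
  given point.\<close>

lemma holomorphic_Mellin_tail:
  assumes "0 < x0" "x0 \<le> 1"
  shows "(\<lambda>s. LINT x:{x0<..}|lborel. complex_of_real x powr (s - 1) * trunc_exp_gf x) holomorphic_on UNIV"
  unfolding set_lebesgue_integral_def
proof (rule holomorphic_on_lebesgue_integral)
  show "(\<lambda>s. indicator {x0<..} x *\<^sub>R (complex_of_real x powr (s - 1) * trunc_exp_gf x)) holomorphic_on UNIV" for x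
    using assms by (cases "x > x0") (auto intro!: holomorphic_intros)
  \<comment> \<open>Measurability of the kernel is extracted from integrability at the exponent 2;
    the factor x^(s-2) then restores the wanted power.\<close>
  have meas2: "(\<lambda>x. indicator {0<..} x *\<^sub>R (complex_of_real x powr (2 - 1) * trunc_exp_gf x)) \<in> borel_measurable lborel"
    using Mellin_trunc_exp_gf(1)[of 2] unfolding set_integrable_def by (intro borel_measurable_integrable) auto
  show "(\<lambda>x. indicator {x0<..} x *\<^sub>R (complex_of_real x powr (s - 1) * trunc_exp_gf x)) \<in> borel_measurable lborel" for s
  proof -
    have "(\<lambda>x. indicator {x0<..} x *\<^sub>R (complex_of_real x powr (s - 2)) * 
            (indicator {0<..} x *\<^sub>R (complex_of_real x powr (2 - 1) * trunc_exp_gf x))) \<in> borel_measurable lborel"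
      using set_borel_measurable_powr[of "{x0<..}" "s - 2"] assms
      by (intro borel_measurable_times meas2) auto
    also have "(\<lambda>x. indicator {x0<..} x *\<^sub>R (complex_of_real x powr (s - 2)) * 
            (indicator {0<..} x *\<^sub>R (complex_of_real x powr (2 - 1) * trunc_exp_gf x))) =
        (\<lambda>x. indicator {x0<..} x *\<^sub>R (complex_of_real x powr (s - 1) * trunc_exp_gf x))"
    proof
      fix x
      have "complex_of_real x powr (s - 2) * complex_of_real x powr (2 - 1) = complex_of_real x powr (s - 1)"
        by (subst powr_add[symmetric]) simp
      thus "indicator {x0<..} x *\<^sub>R (complex_of_real x powr (s - 2)) * 
            (indicator {0<..} x *\<^sub>R (complex_of_real x powr (2 - 1) * trunc_exp_gf x)) =
        indicator {x0<..} x *\<^sub>R (complex_of_real x powr (s - 1) * trunc_exp_gf x)"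
        using assms by (cases "x > x0") (simp_all only: indicator_def, simp_all add: mult.assoc[symmetric] del: powr_one)
    qed
    finally show ?thesis .
  qed
  fix s0 :: complex
  \<comment> \<open>\<open>b\<close> has to exceed 1 for integrability and to bound Re t on the unit
    disc around \<open>s0\<close>. Then x^(Re t - b) is at most its value at \<open>x0\<close>, and
    because \<open>x0 \<le> 1\<close> the worst case is Re t = Re s0 - 1, which gives
    \<open>C\<close>.\<close>
  define b where "b = max 2 (Re s0 + 1)"
  define C where "C = x0 powr - (b - (Re s0 - 1))"
  define g where "g = (\<lambda>x. C * norm (indicator {0<..} x *\<^sub>R (complex_of_real x powr (of_real b - 1) * trunc_exp_gf x)))"
  have "b > 1" by (simp add: b_def)
  hence "integrable lborel g"
    unfolding g_def
    by (intro integrable_mult_right integrable_norm Mellin_trunc_exp_gf(1)[unfolded set_integrable_def]) simp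
  moreover have "norm (indicator {x0<..} x *\<^sub>R (complex_of_real x powr (t - 1) * trunc_exp_gf x)) \<le> g x"
    if "t \<in> cball s0 1" for t x
  proof (cases "x > x0")
    case True
    have x: "x > 0" using True assms by simp
    have Re: "Re t \<le> Re s0 + 1" "Re t \<ge> Re s0 - 1"
      using that abs_Re_le_cmod[of "s0 - t"] by (auto simp: dist_norm)
    have "x powr (Re t - 1) = x powr (b - 1) * x powr - (b - Re t)"
      by (simp add: powr_add[symmetric])
    also have "x powr - (b - Re t) \<le> x0 powr - (b - Re t)"
      using True assms Re by (intro powr_mono2') (auto simp: b_def)
    also have "x0 powr - (b - Re t) \<le> C"
      unfolding C_def using assms Re by (intro powr_mono') auto
    finally have le: "x powr (Re t - 1) \<le> C * x powr (b - 1)"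
      using x by (simp add: mult_ac)
    have "norm (complex_of_real x powr (t - 1)) = x powr (Re t - 1)"
         "norm (complex_of_real x powr (of_real b - 1)) = x powr (b - 1)"
      using x by (simp_all add: norm_powr_real_powr)
    thus ?thesis using True x mult_right_mono[OF le, of "norm (trunc_exp_gf x)"]
      by (simp add: g_def norm_mult mult_ac)
  qed (simp add: g_def C_def)
  ultimately show "\<exists>r>0. \<exists>g. cball s0 r \<subseteq> UNIV \<and> integrable lborel g \<and>
      (\<forall>t\<in>cball s0 r. \<forall>x\<in>space lborel. norm (indicator {x0<..} x *\<^sub>R (complex_of_real x powr (t - 1) * trunc_exp_gf x)) \<le> g x)"
    by (intro exI[of _ 1] conjI exI[of _ g]) auto
qed simp

section \<open>The substitution x = x(w) near w = 0\<close>

lemma integral_substitution_complex: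
  fixes f :: "real \<Rightarrow> complex"
  assumes int: "set_integrable lborel {g a..g b} f"
    and deriv: "\<And>x. x \<in> {a..b} \<Longrightarrow> (g has_real_derivative g' x) (at x)"
    and cont: "continuous_on {a..b} g'"
    and nonneg: "\<And>x. x \<in> {a..b} \<Longrightarrow> g' x \<ge> 0" and "a \<le> b"
  shows "(LINT x:{g a..g b}|lborel. f x) = (LINT x:{a..b}|lborel. f (g x) * of_real (g' x))"
proof -
  define F where "F = (\<lambda>x. indicator {g a..g b} x *\<^sub>R f x)"
  define H where "H = (\<lambda>x. indicator {a..b} x *\<^sub>R (f (g x) * of_real (g' x)))"
  have F: "integrable lborel F" using int by (simp add: F_def set_integrable_def)
  have i: "set_integrable lborel {g a..g b} (\<lambda>x. Re (f x))" "set_integrable lborel {g a..g b} (\<lambda>x. Im (f x))"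
    using integrable_bounded_linear[OF bounded_linear_Re F] integrable_bounded_linear[OF bounded_linear_Im F]
    by (simp_all add: F_def set_integrable_def)
  note subst_Re = integral_substitution[OF i(1) deriv cont nonneg \<open>a \<le> b\<close>]
  note subst_Im = integral_substitution[OF i(2) deriv cont nonneg \<open>a \<le> b\<close>]
  have H_eq: "H = (\<lambda>x. of_real (indicator {a..b} x *\<^sub>R (Re (f (g x)) * g' x)) +
      \<i> * of_real (indicator {a..b} x *\<^sub>R (Im (f (g x)) * g' x)))"
    by (auto simp: H_def fun_eq_iff complex_eq_iff)
  have H: "integrable lborel H"
    unfolding H_eq using subst_Re(1) subst_Im(1) unfolding set_integrable_def
    by (intro Bochner_Integration.integrable_add integrable_mult_right integrable_of_real)
  have "Re (integral\<^sup>L lborel F) = (\<integral>x. Re (F x) \<partial>lborel)"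
    by (rule integral_bounded_linear[OF bounded_linear_Re F, symmetric])
  also have "\<dots> = (\<integral>x. Re (H x) \<partial>lborel)"
    using subst_Re(2) by (simp add: F_def H_def mult_ac)
  also have "\<dots> = Re (integral\<^sup>L lborel H)"
    by (rule integral_bounded_linear[OF bounded_linear_Re H])
  finally have Re: "Re (integral\<^sup>L lborel F) = Re (integral\<^sup>L lborel H)" .
  have "Im (integral\<^sup>L lborel F) = (\<integral>x. Im (F x) \<partial>lborel)"
    by (rule integral_bounded_linear[OF bounded_linear_Im F, symmetric])
  also have "\<dots> = (\<integral>x. Im (H x) \<partial>lborel)"
    using subst_Im(2) by (simp add: F_def H_def mult_ac)
  also have "\<dots> = Im (integral\<^sup>L lborel H)"
    by (rule integral_bounded_linear[OF bounded_linear_Im H])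
  finally have "Im (integral\<^sup>L lborel F) = Im (integral\<^sup>L lborel H)" .
  with Re have "integral\<^sup>L lborel F = integral\<^sup>L lborel H" by (rule complex_eqI)
  thus ?thesis by (simp add: F_def H_def set_lebesgue_integral_def)
qed

text \<open>For Re z < 1 the integrand is unbounded at 0. Absolute integrability therefore comes
  from the real power w^(Re z - 1), and the value from the antiderivative w^z / z, which is
  continuous up to 0 but differentiated only in the interior.\<close>

lemma powr_integral_from_0:
  fixes z :: complex
  assumes z: "Re z > 0" and c: "c > 0"
  shows "set_integrable lborel {0..c} (\<lambda>w. complex_of_real w powr (z - 1))"
    and "(LINT w:{0..c}|lborel. complex_of_real w powr (z - 1)) = of_real c powr z / z"
    and "(LINT w:{0..c}|lborel. norm (complex_of_real w powr (z - 1))) = c powr Re z / Re z"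
proof -
  have norm_eq: "norm (complex_of_real w powr (z - 1)) = w powr (Re z - 1)" if "w \<ge> 0" for w
    using that by (cases "w = 0") (simp_all add: norm_powr_real_powr)
  have "(\<lambda>w. indicator {0<..c} w *\<^sub>R (complex_of_real w powr (z - 1))) \<in> borel_measurable borel"
    by (rule set_borel_measurable_powr) auto
  \<comment> \<open>The endpoint 0 can be added because \<open>powr\<close> with base 0 is
    0.\<close>
  also have "(\<lambda>w. indicator {0<..c} w *\<^sub>R (complex_of_real w powr (z - 1))) =
      (\<lambda>w. indicator {0..c} w *\<^sub>R (complex_of_real w powr (z - 1)))"
    by (auto simp: fun_eq_iff indicator_def)
  finally have meas: "(\<lambda>w. indicator {0..c} w *\<^sub>R (complex_of_real w powr (z - 1))) \<in> borel_measurable borel" .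
  have R: "((\<lambda>w. norm (complex_of_real w powr (z - 1))) has_integral (c powr Re z / Re z)) {0..c}"
    using has_integral_powr_from_0[of "Re z - 1" c] z c
    by (subst has_integral_cong[of _ _ "\<lambda>w. w powr (Re z - 1)"]) (simp_all add: norm_eq)
  have "(\<lambda>w. norm (complex_of_real w powr (z - 1))) absolutely_integrable_on {0..c}"
    using R by (intro nonnegative_absolutely_integrable_1) auto
  hence "integrable lebesgue (\<lambda>w. norm (indicator {0..c} w *\<^sub>R (complex_of_real w powr (z - 1))))"
    by (simp add: set_integrable_def)
  hence i: "integrable lborel (\<lambda>w. norm (indicator {0..c} w *\<^sub>R (complex_of_real w powr (z - 1))))"
    using meas by (subst (asm) integrable_completion) auto
  thus int: "set_integrable lborel {0..c} (\<lambda>w. complex_of_real w powr (z - 1))"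
    unfolding set_integrable_def using meas by (subst (asm) integrable_norm_iff) auto
  have "set_integrable lborel {0..c} (\<lambda>w. norm (complex_of_real w powr (z - 1)))"
    using i by (simp add: set_integrable_def)
  from set_borel_integral_eq_integral(2)[OF this]
  show "(LINT w:{0..c}|lborel. norm (complex_of_real w powr (z - 1))) = c powr Re z / Re z"
    using R by (simp add: integral_unique)
  have "((\<lambda>w. complex_of_real w powr (z - 1)) has_integral (of_real c powr z / z - of_real 0 powr z / z)) {0..c}"
  proof (rule fundamental_theorem_of_calculus_interior)
    show "continuous_on {0..c} (\<lambda>w. complex_of_real w powr z / z)"
      using z by (intro continuous_intros) auto
    fix w assume w: "w \<in> {0<..<c}"
    have "((\<lambda>w. w powr z / z) has_field_derivative (of_real w powr (z - 1))) (at (complex_of_real w))"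
      using w z by (auto intro!: derivative_eq_intros simp: complex_nonpos_Reals_iff)
    thus "((\<lambda>w. complex_of_real w powr z / z) has_vector_derivative of_real w powr (z - 1)) (at w)"
      by (rule has_vector_derivative_real_field)
  qed (use c in auto)
  thus "(LINT w:{0..c}|lborel. complex_of_real w powr (z - 1)) = of_real c powr z / z"
    using set_borel_integral_eq_integral(2)[OF int] by (simp add: integral_unique)
qed

text \<open>The function x(w) of the overview. The name refers to the tree function, the inverse of
  T e^(-T) on the branch through 0, which takes the value 1 - w at e^(-1-x).\<close>

definition tree_exponent :: "real \<Rightarrow> real" where
  "tree_exponent w = - w - ln (1 - w)"

lemma tree_exponent_0 [simp]: "tree_exponent 0 = 0"
  by (simp add: tree_exponent_def)

lemma tree_exponent_deriv: "w < 1 \<Longrightarrow> (tree_exponent has_real_derivative (w / (1 - w))) (at w)"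
  unfolding tree_exponent_def by (auto intro!: derivative_eq_intros simp: field_simps)

lemma trunc_exp_gf_tree_exponent:
  assumes "0 < w" "w < 1"
  shows "trunc_exp_gf (tree_exponent w) = 1 / of_real w ^ 2 - 1"
proof -
  define T where "T = complex_of_real (1 - w)"
  have exp_X: "exp (- tree_exponent w) = (1 - w) * exp w"
    using assms by (simp add: tree_exponent_def exp_add)
  \<comment> \<open>Strict because w > 0; this amounts to |T e^(1-T)| < 1. At w = 0 equality would
    hold, on the boundary of the admissible region.\<close>
  have "1 - w < exp (- w)"
    using exp_minus_greater[of w] assms by simp
  hence "(1 - w) * exp w < exp (- w) * exp w"
    by (intro mult_strict_right_mono) auto
  hence 1: "(1 - w) * exp w < 1" by (simp add: mult_exp_exp)
  have n: "norm (T * exp (1 - T)) < 1" "norm T < 1"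
    using assms 1 by (simp_all add: T_def norm_mult del: of_real_diff) 
  have T: "T * exp (- T) = of_real (exp (- 1) * exp (- tree_exponent w))"
    unfolding exp_X T_def by (simp add: exp_of_real[symmetric] exp_minus exp_diff field_simps)
  have term_eq: "trunc_exp n * (T * exp (- T)) ^ n =
      trunc_exp n * of_real (exp (- real n)) * of_real (exp (- (real n * tree_exponent w)))" for n
    unfolding T using exp_of_nat_mult[of n "-1 :: real"] exp_of_nat_mult[of n "- tree_exponent w"]
    by (simp add: power_mult_distrib)
  have "(\<lambda>n. trunc_exp n * (T * exp (- T)) ^ n) sums (1 / (1 - T) ^ 2)"
    by (rule sums_trunc_exp_tree[OF n])
  hence "(\<lambda>n. trunc_exp (Suc n) * (T * exp (- T)) ^ Suc n) sums (1 / (1 - T) ^ 2 - 1)"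
    by (subst sums_Suc_iff) (simp add: trunc_exp_def)
  thus ?thesis unfolding term_eq trunc_exp_gf_def sums_iff by (simp add: T_def)
qed

text \<open>
  At the poles $s = 1 - k/2$ the $k$-th term is 0 (division by zero), so the series converges everywhere.
\<close>
definition head_series :: "complex \<Rightarrow> complex" where
  "head_series s = (\<Sum>k. D_coeff k s * (1 / 4) ^ k / (2 * s - 2 + of_nat k))"

text \<open>Two factorisations: x = (w^2/2) B(w) splits the power x^(s-1), and (1/w^2 - 1) times
  dx/dw collapses to (1 + w)/w. The latter accounts for the factor 1 + w in \<open>D_coeff\<close>
  and for the exponent 2s - 3.\<close>

lemma Mellin_head_integrand:
  assumes w: "0 < w" "w \<le> 1 / 4"
  shows "(\<lambda>k. 2 powr (1 - s) * D_coeff k s * complex_of_real w powr (2 * s - 2 + of_nat k - 1)) sums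
           (of_real (tree_exponent w) powr (s - 1) * trunc_exp_gf (tree_exponent w) * of_real (w / (1 - w)))"
proof -
  define b where "b = 2 * tree_exponent w / w ^ 2"
  have "of_real w ^ 2 / 2 * A_base_eval (of_real w) = of_real (tree_exponent w)"
    using A_base_eval_eq[of "of_real w"] w Ln_of_real[of "1 - w"] by (simp add: tree_exponent_def)
  hence Bw: "A_base_eval (of_real w) = of_real b"
    using w by (simp add: b_def field_simps)
  have Xw: "complex_of_real (tree_exponent w) = of_real (w ^ 2 / 2) * A_base_eval (of_real w)"
    using w unfolding Bw by (simp add: b_def)
  \<comment> \<open>Principal powers are not multiplicative in general; here one factor is a
    nonnegative real.\<close>
  have "of_real (tree_exponent w) powr (s - 1) = of_real (w ^ 2 / 2) powr (s - 1) * A_base_eval (of_real w) powr (s - 1)"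
    unfolding Xw by (rule powr_times_real_left) auto
  also have "complex_of_real (w ^ 2 / 2) powr (s - 1) = 2 powr (1 - s) * of_real w powr (2 * s - 2)"
  proof -
    \<comment> \<open>Logarithms of positive reals expand without a branch correction, which
      justifies (w^2)^(s-1) = w^(2s-2) for complex s.\<close>
    have L1: "Ln (complex_of_real (w ^ 2 / 2)) = 2 * of_real (ln w) - of_real (ln 2)"
      using w by (subst Ln_of_real) (simp_all add: ln_div ln_realpow)
    have L2: "Ln 2 = complex_of_real (ln 2)" "Ln (complex_of_real w) = of_real (ln w)"
      using w Ln_of_real[of 2] by (simp_all add: Ln_of_real)
    have "complex_of_real (w ^ 2 / 2) \<noteq> 0" "complex_of_real w \<noteq> 0"
      using w by simp_all
    thus ?thesis
      by (simp only: powr_def L1 L2 if_False) (simp add: algebra_simps flip: exp_add)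
  qed
  finally have 1: "of_real (tree_exponent w) powr (s - 1) =
    2 powr (1 - s) * of_real w powr (2 * s - 2) * A_base_eval (of_real w) powr (s - 1)" .
  have 2: "trunc_exp_gf (tree_exponent w) * of_real (w / (1 - w)) = (1 + of_real w) / of_real w"
  proof -
    have "(1 / w ^ 2 - 1) * (w / (1 - w)) = (1 + w) / w"
      using w by (simp add: field_simps power2_eq_square)
    hence "complex_of_real ((1 / w ^ 2 - 1) * (w / (1 - w))) = of_real ((1 + w) / w)" by (simp only:)
    thus ?thesis using trunc_exp_gf_tree_exponent[of w] w by simp
  qed
  have "(\<lambda>k. 2 powr (1 - s) * of_real w powr (2 * s - 2) / of_real w * (D_coeff k s * of_real w ^ k)) sums
      (2 powr (1 - s) * of_real w powr (2 * s - 2) / of_real w * ((1 + of_real w) * A_base_eval (of_real w) powr (s - 1)))"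
    by (intro sums_mult D_coeff_sums) (use w in auto)
  also have "2 powr (1 - s) * of_real w powr (2 * s - 2) / of_real w * ((1 + of_real w) * A_base_eval (of_real w) powr (s - 1)) =
      of_real (tree_exponent w) powr (s - 1) * (trunc_exp_gf (tree_exponent w) * of_real (w / (1 - w)))"
    unfolding 1 2 by simp
  also have "(\<lambda>k. 2 powr (1 - s) * of_real w powr (2 * s - 2) / of_real w * (D_coeff k s * of_real w ^ k)) =
      (\<lambda>k. 2 powr (1 - s) * D_coeff k s * complex_of_real w powr (2 * s - 2 + of_nat k - 1))"
  proof
    fix k
    have "complex_of_real w powr (2 * s - 2 + of_nat k - 1) = of_real w powr (2 * s - 2) * of_real w ^ k / of_real w"
      using w by (subst powr_diff, subst powr_add) simp
    thus "2 powr (1 - s) * of_real w powr (2 * s - 2) / of_real w * (D_coeff k s * of_real w ^ k) =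
        2 powr (1 - s) * D_coeff k s * complex_of_real w powr (2 * s - 2 + of_nat k - 1)"
      by simp
  qed
  finally show ?thesis by (simp add: mult.assoc)
qed

text \<open>For Re s > 1 every power of exponent 2s - 3 + k is integrable at 0, and the bound C 3^k
  for D_k against (1/4)^k makes both the pointwise norms and their integrals geometric with ratio
  3/4.\<close>

lemma Mellin_head:
  assumes s: "Re s > 1"
  shows "(LINT x:{0..tree_exponent (1 / 4)}|lborel. complex_of_real x powr (s - 1) * trunc_exp_gf x) =
           2 powr (1 - s) * (1 / 4) powr (2 * s - 2) * head_series s"
proof -
  define a where "a = 2 * Re s - 2"
  have a: "a > 0" using s by (simp add: a_def)
  define f where "f = (\<lambda>k w. indicator {0..1 / 4} w *\<^sub>R
     (2 powr (1 - s) * D_coeff k s * complex_of_real w powr (2 * s - 2 + of_nat k - 1)))"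
  define p where "p = (\<lambda>k w. indicator {0..1 / 4} w *\<^sub>R (complex_of_real w powr (2 * s - 2 + of_nat k - 1)))"
  have f_eq: "f k = (\<lambda>w. 2 powr (1 - s) * D_coeff k s * p k w)" for k
    by (simp add: f_def p_def fun_eq_iff)
  have Re_pos: "Re (2 * s - 2 + of_nat k) > 0" for k using s by simp
  have p_int: "integrable lborel (p k)"
    and p_val: "integral\<^sup>L lborel (p k) = (1 / 4) powr (2 * s - 2 + of_nat k) / (2 * s - 2 + of_nat k)"
    and p_norm: "(\<integral>w. norm (p k w) \<partial>lborel) = (1 / 4) powr (a + real k) / (a + real k)" for k
    using powr_integral_from_0[OF Re_pos, of "1 / 4" k]
    by (simp_all add: p_def set_integrable_def set_lebesgue_integral_def a_def)
  obtain C where C: "C > 0" "\<And>k. norm (D_coeff k s) \<le> C * 3 ^ k"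
    using norm_D_coeff_le[of "norm s"] by (metis order_refl)
  define K where "K = norm ((2 :: complex) powr (1 - s))"
  have int: "integrable lborel (f k)" for k
    unfolding f_eq by (intro integrable_mult_right p_int)
  have val: "integral\<^sup>L lborel (f k) = 2 powr (1 - s) * (1 / 4) powr (2 * s - 2) * 
               (D_coeff k s * (1 / 4) ^ k / (2 * s - 2 + of_nat k))" for k
    unfolding f_eq integral_mult_right_zero p_val by (simp add: powr_add)
  have norm_val: "(\<integral>w. norm (f k w) \<partial>lborel) = K * norm (D_coeff k s) * ((1 / 4) powr (a + real k) / (a + real k))" for k
    unfolding f_eq norm_mult integral_mult_right_zero p_norm K_def by simp
  \<comment> \<open>At w = 0 both sides vanish: powers of 0 are 0, and so is the Jacobian w/(1 -
    w).\<close>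
  have pointwise: "(\<lambda>k. f k w) sums
      (indicator {0..1 / 4} w *\<^sub>R (of_real (tree_exponent w) powr (s - 1) * trunc_exp_gf (tree_exponent w) * of_real (w / (1 - w))))" for w
    using Mellin_head_integrand[of w s] by (cases "0 < w \<and> w \<le> 1 / 4") (auto simp: f_def indicator_def)
  have sum_norm: "summable (\<lambda>k. norm (f k w))" for w
  proof (cases "0 < w \<and> w \<le> 1 / 4")
    case True
    show ?thesis
    proof (rule summable_comparison_test)
      show "\<exists>N. \<forall>k\<ge>N. norm (norm (f k w)) \<le> K * C * w powr (a - 1) * (3 / 4) ^ k"
      proof (intro exI[of _ 0] allI impI)
        fix k
        have "norm (complex_of_real w powr (2 * s - 2 + of_nat k - 1)) = w powr (a - 1 + real k)"
          using True by (simp add: norm_powr_real_powr a_def algebra_simps)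
        also have "\<dots> = w powr (a - 1) * w ^ k"
          using True by (simp add: powr_add powr_realpow)
        also have "\<dots> \<le> w powr (a - 1) * (1 / 4) ^ k"
          using True by (intro mult_left_mono power_mono) auto
        finally have le: "norm (complex_of_real w powr (2 * s - 2 + of_nat k - 1)) \<le> w powr (a - 1) * (1 / 4) ^ k" .
        have "norm (norm (f k w)) = K * (norm (D_coeff k s) * norm (complex_of_real w powr (2 * s - 2 + of_nat k - 1)))"
          using True by (simp add: f_def K_def norm_mult)
        also have "\<dots> \<le> K * ((C * 3 ^ k) * (w powr (a - 1) * (1 / 4) ^ k))"
          using C le by (intro mult_left_mono mult_mono) (auto simp: K_def less_imp_le)
        also have "\<dots> = K * C * w powr (a - 1) * (3 / 4) ^ k"
          by (simp add: power_divide)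
        finally show "norm (norm (f k w)) \<le> K * C * w powr (a - 1) * (3 / 4) ^ k" .
      qed
    qed (intro summable_mult summable_geometric, simp)
  qed (auto simp: f_def indicator_def)
  have sum_int: "summable (\<lambda>k. \<integral>w. norm (f k w) \<partial>lborel)"
  proof (rule summable_comparison_test)
    show "\<exists>N. \<forall>k\<ge>N. norm (\<integral>w. norm (f k w) \<partial>lborel) \<le> K * C * ((1 / 4) powr a / a) * (3 / 4) ^ k"
    proof (intro exI[of _ 0] allI impI)
      fix k
      have "(1 / 4) powr (a + real k) / (a + real k) \<le> (1 / 4) powr (a + real k) / a"
        using a by (intro divide_left_mono) (auto intro: mult_pos_pos)
      also have "\<dots> = (1 / 4) powr a / a * (1 / 4) ^ k"
        by (simp add: powr_add powr_realpow)
      finally have le: "(1 / 4) powr (a + real k) / (a + real k) \<le> (1 / 4) powr a / a * (1 / 4) ^ k" .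
      have "norm (\<integral>w. norm (f k w) \<partial>lborel) = K * (norm (D_coeff k s) * ((1 / 4) powr (a + real k) / (a + real k)))"
        using a unfolding norm_val by (simp add: K_def abs_mult)
      also have "\<dots> \<le> K * ((C * 3 ^ k) * ((1 / 4) powr a / a * (1 / 4) ^ k))"
        using C le a by (intro mult_left_mono mult_mono) (auto simp: K_def less_imp_le)
      also have "\<dots> = K * C * ((1 / 4) powr a / a) * (3 / 4) ^ k"
        by (simp add: power_divide)
      finally show "norm (\<integral>w. norm (f k w) \<partial>lborel) \<le> K * C * ((1 / 4) powr a / a) * (3 / 4) ^ k" .
    qed
  qed (intro summable_mult summable_geometric, simp)
  \<comment> \<open>The substitution rule is stated for closed intervals; the integrand is 0 at x =
    0, so adding that endpoint changes nothing.\<close>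
  have X_le: "set_integrable lborel {tree_exponent 0..tree_exponent (1 / 4)} (\<lambda>x. complex_of_real x powr (s - 1) * trunc_exp_gf x)"
  proof -
    have "set_integrable lborel {0<..tree_exponent (1 / 4)} (\<lambda>x. complex_of_real x powr (s - 1) * trunc_exp_gf x)"
      by (rule set_integrable_subset[OF Mellin_trunc_exp_gf(1)[OF s]]) auto
    moreover have "(\<lambda>x. indicator {0<..tree_exponent (1 / 4)} x *\<^sub>R (complex_of_real x powr (s - 1) * trunc_exp_gf x)) =
        (\<lambda>x. indicator {tree_exponent 0..tree_exponent (1 / 4)} x *\<^sub>R (complex_of_real x powr (s - 1) * trunc_exp_gf x))"
      by (auto simp: fun_eq_iff indicator_def)
    ultimately show ?thesis unfolding set_integrable_def by simp
  qed
  have "(LINT x:{tree_exponent 0..tree_exponent (1 / 4)}|lborel. complex_of_real x powr (s - 1) * trunc_exp_gf x) =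
      (LINT w:{0..1 / 4}|lborel. of_real (tree_exponent w) powr (s - 1) * trunc_exp_gf (tree_exponent w) * of_real (w / (1 - w)))"
    using X_le by (intro integral_substitution_complex[where g = tree_exponent]) (auto intro!: tree_exponent_deriv continuous_intros)
  also have "\<dots> = (\<integral>w. (\<Sum>k. f k w) \<partial>lborel)"
    unfolding set_lebesgue_integral_def using sums_unique[OF pointwise] by simp
  also have "\<dots> = (\<Sum>k. integral\<^sup>L lborel (f k))"
    by (rule integral_suminf[OF int _ sum_int]) (use sum_norm in auto)
  also have "\<dots> = 2 powr (1 - s) * (1 / 4) powr (2 * s - 2) * head_series s"
  proof -
    have "summable (\<lambda>k. integral\<^sup>L lborel (f k))"
      by (rule summable_integral[OF int _ sum_int]) (use sum_norm in auto)
    hence "summable (\<lambda>k. D_coeff k s * (1 / 4) ^ k / (2 * s - 2 + of_nat k))"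
      unfolding val by (subst (asm) summable_cmult_iff) auto
    thus ?thesis unfolding val head_series_def by (rule suminf_mult)
  qed
  finally show ?thesis by simp
qed

section \<open>Poles of the head series\<close>

lemma head_series_split:
  assumes K: "real K \<ge> 2 * R + 3"
  obtains H where "H holomorphic_on ball 0 R"
    "\<And>s. s \<in> ball 0 R \<Longrightarrow> head_series s = (\<Sum>k<K. D_coeff k s * (1 / 4) ^ k / (2 * s - 2 + of_nat k)) + H s"
proof -
  define t where "t = (\<lambda>k s. D_coeff k s * (1 / 4) ^ k / (2 * s - 2 + of_nat k))"
  obtain C where C: "C > 0" "\<And>k s. norm s \<le> R \<Longrightarrow> norm (D_coeff k s) \<le> C * 3 ^ k"
    using norm_D_coeff_le[of R] by metis
  \<comment> \<open>In the disc Re (2s - 2) > -2R - 2, so from index K \<ge> 2R + 3 on the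
    denominators have real part at least 1. Poles in the disc can only come from the first K
    terms.\<close>
  have ge: "norm (2 * s - 2 + of_nat (k + K)) \<ge> 1" if "s \<in> ball 0 R" for s :: complex and k
  proof -
    have "\<bar>Re s\<bar> < R" using that abs_Re_le_cmod[of s] by simp
    hence "1 \<le> Re (2 * s - 2 + of_nat (k + K))" using K by simp
    thus ?thesis using complex_Re_le_cmod order_trans by blast
  qed
  have bound: "norm (t (k + K) s) \<le> C * (3 / 4) ^ (k + K)" if s: "s \<in> ball 0 R" for s :: complex and k
  proof -
    have "norm (t (k + K) s) = norm (D_coeff (k + K) s) * (1 / 4) ^ (k + K) / norm (2 * s - 2 + of_nat (k + K))"
      by (simp add: t_def norm_divide norm_mult norm_power)
    also have "\<dots> \<le> (C * 3 ^ (k + K)) * (1 / 4) ^ (k + K) / 1"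
      using ge[OF s, of k] C(2)[of s] s \<open>C > 0\<close> by (intro frac_le mult_right_mono) auto
    also have "\<dots> = C * (3 / 4) ^ (k + K)" by (simp add: power_divide)
    finally show ?thesis .
  qed
  have sumC: "summable (\<lambda>k. C * (3 / 4 :: real) ^ (k + K))"
    by (intro summable_mult summable_ignore_initial_segment summable_geometric) simp
  define H where "H = (\<lambda>s. \<Sum>k. t (k + K) s)"
  have unif: "uniform_limit (ball 0 R) (\<lambda>n s. \<Sum>k<n. t (k + K) s) H sequentially"
    unfolding H_def by (rule Weierstrass_m_test[OF _ sumC]) (use bound in auto)
  show ?thesis
  proof (rule that)
    show "H holomorphic_on ball 0 R"
    proof (rule holomorphic_uniform_sequence)
      fix n
      have "t (k + K) holomorphic_on ball 0 R" for k
        unfolding t_def using ge[of _ k]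
        by (intro holomorphic_intros holomorphic_D_coeff) fastforce
      thus "(\<lambda>s. \<Sum>k<n. t (k + K) s) holomorphic_on ball 0 R"
        by (intro holomorphic_intros)
    next
      fix s :: complex assume "s \<in> ball 0 R"
      then obtain d where d: "d > 0" "cball s d \<subseteq> ball 0 R"
        using open_contains_cball by blast
      thus "\<exists>d>0. cball s d \<subseteq> ball 0 R \<and> uniform_limit (cball s d) (\<lambda>n s. \<Sum>k<n. t (k + K) s) H sequentially"
        using uniform_limit_on_subset[OF unif] by blast
    qed auto
    fix s :: complex assume s: "s \<in> ball 0 R"
    have "summable (\<lambda>k. t (k + K) s)"
      by (rule summable_comparison_test[OF _ sumC]) (use bound[OF s] in auto)
    hence "summable (\<lambda>k. t k s)" by (subst (asm) summable_iff_shift)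
    hence "(\<Sum>k. t k s) = (\<Sum>k. t (k + K) s) + (\<Sum>k<K. t k s)"
      by (rule suminf_split_initial_segment)
    thus "head_series s = (\<Sum>k<K. D_coeff k s * (1 / 4) ^ k / (2 * s - 2 + of_nat k)) + H s"
      unfolding head_series_def H_def t_def by (simp only: add.commute)
  qed
qed

lemma meromorphic_head_series: "head_series meromorphic_on UNIV"
proof (subst meromorphic_on_meromorphic_at, intro ballI)
  fix z :: complex
  define R where "R = norm z + 1"
  obtain K :: nat where K: "real K \<ge> 2 * R + 3" using real_arch_simple by blast
  obtain H where H: "H holomorphic_on ball 0 R"
    "\<And>s. s \<in> ball 0 R \<Longrightarrow> head_series s = (\<Sum>k<K. D_coeff k s * (1 / 4) ^ k / (2 * s - 2 + of_nat k)) + H s"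
    by (rule head_series_split[OF K], rule that)
  have z: "z \<in> ball 0 R" by (simp add: R_def)
  have an: "H analytic_on {z}" "D_coeff k analytic_on {z}" for k
    using H(1) z holomorphic_D_coeff[of k UNIV] open_ball open_UNIV unfolding analytic_at by blast+
  have "eventually (\<lambda>s. s \<in> ball 0 R) (at z)"
    using z by (intro eventually_at_in_open') auto
  hence "eventually (\<lambda>s. head_series s = (\<Sum>k<K. D_coeff k s * (1 / 4) ^ k / (2 * s - 2 + of_nat k)) + H s) (at z)"
    by eventually_elim (rule H(2))
  moreover have "(\<lambda>s. (\<Sum>k<K. D_coeff k s * (1 / 4) ^ k / (2 * s - 2 + of_nat k)) + H s) meromorphic_on {z}"
    by (intro meromorphic_intros analytic_on_imp_meromorphic_on an)
  ultimately show "head_series meromorphic_on {z}"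
    by (subst meromorphic_on_cong) auto
qed

text \<open>All denominators have positive real part when Re s > 1. This guarantees that removing
  singularities later leaves the values in the half-plane of convergence untouched.\<close>

lemma holomorphic_head_series: "head_series holomorphic_on {s. Re s > 1}"
proof (rule analytic_imp_holomorphic, subst analytic_on_analytic_at, intro ballI)
  fix z :: complex assume "z \<in> {s. Re s > 1}"
  hence z1: "Re z > 1" by simp
  define R where "R = norm z + 1"
  obtain K :: nat where K: "real K \<ge> 2 * R + 3" using real_arch_simple by blast
  obtain H where H: "H holomorphic_on ball 0 R"
    "\<And>s. s \<in> ball 0 R \<Longrightarrow> head_series s = (\<Sum>k<K. D_coeff k s * (1 / 4) ^ k / (2 * s - 2 + of_nat k)) + H s"
    by (rule head_series_split[OF K], rule that)
  have z: "z \<in> ball 0 R" by (simp add: R_def)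
  have an: "H analytic_on {z}" "D_coeff k analytic_on {z}" for k
    using H(1) z holomorphic_D_coeff[of k UNIV] open_ball open_UNIV unfolding analytic_at by blast+
  have nz: "2 * z - 2 + of_nat k \<noteq> 0" for k
    using z1 by (auto simp: complex_eq_iff)
  have "eventually (\<lambda>s. s \<in> ball 0 R) (nhds z)"
    using z by (intro eventually_nhds_in_open) auto
  hence "eventually (\<lambda>s. head_series s = (\<Sum>k<K. D_coeff k s * (1 / 4) ^ k / (2 * s - 2 + of_nat k)) + H s) (nhds z)"
    by eventually_elim (rule H(2))
  moreover have "(\<lambda>s. (\<Sum>k<K. D_coeff k s * (1 / 4) ^ k / (2 * s - 2 + of_nat k)) + H s) analytic_on {z}"
    using nz by (intro analytic_intros an) auto
  ultimately show "head_series analytic_on {z}"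
    by (subst analytic_at_cong) auto
qed

text \<open>Only the k-th term can be singular at \<open>s0\<close>, and its denominator is 2(s -
  s0), whence the division by 2. Everything else is continuous there and is killed by the factor s -
  s0.\<close>

lemma head_series_residue:
  fixes k :: nat
  defines "s0 \<equiv> 1 - of_nat k / 2"
  shows "((\<lambda>s. head_series s * (s - s0)) \<longlongrightarrow> D_coeff k s0 * (1 / 4) ^ k / 2) (at s0)"
proof -
  define R where "R = norm s0 + 1"
  obtain K :: nat where "real K \<ge> max (2 * R + 3) (real (Suc k))" using real_arch_simple by blast
  hence K: "real K \<ge> 2 * R + 3" "K > k" by auto
  obtain H where H: "H holomorphic_on ball 0 R"
    "\<And>s. s \<in> ball 0 R \<Longrightarrow> head_series s = (\<Sum>k<K. D_coeff k s * (1 / 4) ^ k / (2 * s - 2 + of_nat k)) + H s"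
    by (rule head_series_split[OF K(1)], rule that)
  have s0: "s0 \<in> ball 0 R" by (simp add: R_def)
  have contD: "isCont (D_coeff j) s0" for j
    using holomorphic_on_imp_continuous_on[OF holomorphic_D_coeff[of j UNIV]]
    by (simp add: continuous_on_eq_continuous_at)
  have contH: "isCont H s0"
    using holomorphic_on_imp_continuous_on[OF H(1)] s0 by (simp add: continuous_on_eq_continuous_at)
  have nz: "2 * s0 - 2 + of_nat j \<noteq> 0" if "j \<noteq> k" for j
    using that by (simp add: s0_def)
  define r where "r = (\<lambda>s. (\<Sum>j\<in>{..<K}-{k}. D_coeff j s * (1 / 4) ^ j / (2 * s - 2 + of_nat j)) + H s)"
  have "isCont r s0"
    unfolding r_def using nz by (intro continuous_intros contD contH) auto
  hence "isCont (\<lambda>s. D_coeff k s * (1 / 4) ^ k / 2 + r s * (s - s0)) s0"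
    by (intro continuous_intros contD) auto
  hence "((\<lambda>s. D_coeff k s * (1 / 4) ^ k / 2 + r s * (s - s0)) \<longlongrightarrow> D_coeff k s0 * (1 / 4) ^ k / 2) (at s0)"
    by (simp add: isCont_def)
  moreover have "eventually (\<lambda>s. head_series s * (s - s0) = D_coeff k s * (1 / 4) ^ k / 2 + r s * (s - s0)) (at s0)"
  proof -
    have "eventually (\<lambda>s. s \<in> ball 0 R) (at s0)" "eventually (\<lambda>s. s \<noteq> s0) (at s0)"
      using s0 by (intro eventually_at_in_open' eventually_neq_at_within; auto)+
    thus ?thesis
    proof eventually_elim
      case (elim s)
      have den: "2 * s - 2 + of_nat k = 2 * (s - s0)" by (simp add: s0_def)
      have "head_series s = D_coeff k s * (1 / 4) ^ k / (2 * s - 2 + of_nat k) + r s"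
        using K(2) elim unfolding r_def H(2)[OF elim(1)] by (subst sum.remove[of _ k]) auto
      thus ?case unfolding den using elim(2) by (simp add: divide_simps) (simp add: algebra_simps)
    qed
  qed
  ultimately show ?thesis by (subst tendsto_cong)
qed

subsection \<open>The meromorphic continuation\<close>

definition tail_integral :: "complex \<Rightarrow> complex" where
  "tail_integral s = (LINT x:{tree_exponent (1 / 4)<..}|lborel. complex_of_real x powr (s - 1) * trunc_exp_gf x)"

text \<open>The continuation of Gamma(s) M(s) rather than of M(s), so that its poles at s = 1 - k/2
  are visible termwise. The power of 1/4 is the endpoint contribution common to all integrated
  terms.\<close>

definition mellin_ext :: "complex \<Rightarrow> complex" where
  "mellin_ext s = 2 powr (1 - s) * (1 / 4) powr (2 * s - 2) * head_series s + tail_integral s"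

lemma tree_exponent_quarter: "0 < tree_exponent (1 / 4)" "tree_exponent (1 / 4) \<le> 1"
proof -
  have "ln (3 / 4 :: real) \<le> 3 / 4 - 1" by (rule ln_le_minus_one) simp
  moreover have "ln (3 / 4 :: real) \<noteq> 3 / 4 - 1" using ln_eq_minus_one[of "3 / 4"] by auto
  ultimately show "0 < tree_exponent (1 / 4)" by (simp add: tree_exponent_def)
  have "ln (4 / 3 :: real) \<le> 4 / 3 - 1" by (rule ln_le_minus_one) simp
  thus "tree_exponent (1 / 4) \<le> 1" by (simp add: tree_exponent_def ln_div)
qed

lemma holomorphic_tail_integral: "tail_integral holomorphic_on UNIV"
  unfolding tail_integral_def[abs_def] by (rule holomorphic_Mellin_tail) (fact tree_exponent_quarter)+

lemma mellin_ext_eq: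
  assumes s: "Re s > 1"
  shows "mellin_ext s = Gamma s * M_series s"
proof -
  let ?f = "\<lambda>x. complex_of_real x powr (s - 1) * trunc_exp_gf x"
  let ?c = "tree_exponent (1 / 4)"
  note int = Mellin_trunc_exp_gf(1)[OF s]
  have "Gamma s * M_series s = (LINT x:{0<..}|lborel. ?f x)"
    using Mellin_trunc_exp_gf(2)[OF s] by simp
  also have "{0<..} = {0<..?c} \<union> {?c<..}" using tree_exponent_quarter by auto
  also have "(LINT x:{0<..?c} \<union> {?c<..}|lborel. ?f x) =
      (LINT x:{0<..?c}|lborel. ?f x) + (LINT x:{?c<..}|lborel. ?f x)"
    using tree_exponent_quarter by (intro set_integral_Un set_integrable_subset[OF int]) auto
  also have "(LINT x:{0<..?c}|lborel. ?f x) = (LINT x:{0..?c}|lborel. ?f x)"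
    unfolding set_lebesgue_integral_def
    by (intro Bochner_Integration.integral_cong) (auto simp: indicator_def)
  finally show ?thesis by (simp add: mellin_ext_def tail_integral_def Mellin_head[OF s])
qed

lemma meromorphic_mellin_ext: "mellin_ext meromorphic_on UNIV"
proof -
  have "(\<lambda>s. 2 powr (1 - s) * (1 / 4) powr (2 * s - 2)) holomorphic_on (UNIV :: complex set)"
    by (intro holomorphic_intros) auto
  hence "(\<lambda>s. 2 powr (1 - s) * (1 / 4) powr (2 * s - 2) :: complex) meromorphic_on UNIV"
    by (intro analytic_on_imp_meromorphic_on) (simp add: analytic_on_open)
  moreover have "tail_integral meromorphic_on UNIV"
    using holomorphic_tail_integral by (intro analytic_on_imp_meromorphic_on) (simp add: analytic_on_open)
  ultimately show ?thesis
    unfolding mellin_ext_def[abs_def] by (intro meromorphic_on_add meromorphic_on_mult[OF _ meromorphic_head_series])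
qed

lemma meromorphic_rGamma_mellin_ext: "(\<lambda>s. rGamma s * mellin_ext s) meromorphic_on UNIV"
  by (intro meromorphic_intros meromorphic_mellin_ext analytic_on_imp_meromorphic_on analytic_rGamma)

text \<open>At -N the factor \<open>rGamma\<close> is 0, so the plain product takes the value 0
  there, whereas the intended value is its limit. Removing singularities repairs this and assigns 0
  to poles, in agreement with the normalisation of \<open>M\<close>.\<close>

lemma M_eq_remove_sings: "M = remove_sings (\<lambda>s. rGamma s * mellin_ext s)"
  and nicely_meromorphic_M: "M nicely_meromorphic_on UNIV"
proof -
  let ?g = "\<lambda>s. rGamma s * mellin_ext s"
  have nice: "remove_sings ?g nicely_meromorphic_on UNIV"
    by (rule remove_sings_nicely_meromorphic[OF meromorphic_rGamma_mellin_ext])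
  have eq: "remove_sings ?g s = M_series s" if s: "Re s > 1" for s
  proof -
    have op: "open {s. Re s > 1}" by (rule open_halfspace_Re_gt)
    have "mellin_ext holomorphic_on {s. Re s > 1}"
      unfolding mellin_ext_def
      by (intro holomorphic_intros holomorphic_head_series holomorphic_on_subset[OF holomorphic_tail_integral]) auto
    hence "?g holomorphic_on {s. Re s > 1}"
      by (intro holomorphic_intros)
    hence "?g analytic_on {s}"
      using op s unfolding analytic_at by blast
    hence "remove_sings ?g s = ?g s" by (rule remove_sings_at_analytic)
    also have "\<dots> = M_series s"
    proof -
      have "s \<notin> \<int>\<^sub>\<le>\<^sub>0" using s by (auto elim!: nonpos_Ints_cases')
      hence "rGamma s * Gamma s = 1" by (simp add: Gamma_def rGamma_eq_zero_iff)
      thus ?thesis by (simp add: mellin_ext_eq[OF s] mult.assoc[symmetric])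
    qed
    finally show ?thesis .
  qed
  show M: "M = remove_sings ?g"
    unfolding M_def
  proof (rule the_equality)
    show "remove_sings ?g nicely_meromorphic_on UNIV \<and> (\<forall>s. 1 < Re s \<longrightarrow> remove_sings ?g s = M_series s)"
      using nice eq by blast
  qed (use nice eq M_continuation_unique in blast)
  show "M nicely_meromorphic_on UNIV" unfolding M by (rule nice)
qed

lemma eventually_M_eq: "eventually (\<lambda>s. M s = rGamma s * mellin_ext s) (at s0)"
  unfolding M_eq_remove_sings
  by (rule eventually_remove_sings_eq_at)
     (use meromorphic_rGamma_mellin_ext in \<open>auto simp: meromorphic_on_altdef\<close>)

text \<open>At \<open>s0\<close> the power (1/4)^(2s-2) equals 4^k and cancels the (1/4)^k of the
  head series: the residue does not depend on the cut point. The tail is entire and contributes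
  nothing.\<close>

lemma mellin_ext_residue:
  fixes k :: nat
  defines "s0 \<equiv> 1 - of_nat k / 2"
  shows "((\<lambda>s. mellin_ext s * (s - s0)) \<longlongrightarrow> 2 powr (- s0) * D_coeff k s0) (at s0)"
proof -
  let ?p = "\<lambda>s :: complex. 2 powr (1 - s) * (1 / 4) powr (2 * s - 2)"
  have "isCont ?p s0"
    by (intro continuous_intros) auto
  moreover have "isCont tail_integral s0"
    using holomorphic_on_imp_continuous_on[OF holomorphic_tail_integral] by (simp add: continuous_on_eq_continuous_at)
  ultimately have "((\<lambda>s. ?p s * (head_series s * (s - s0)) + tail_integral s * (s - s0)) \<longlongrightarrow>
      ?p s0 * (D_coeff k s0 * (1 / 4) ^ k / 2) + tail_integral s0 * (s0 - s0)) (at s0)"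
    unfolding isCont_def s0_def
    by (intro tendsto_add tendsto_mult[OF _ head_series_residue]
        tendsto_mult[OF _ tendsto_diff[OF tendsto_ident_at tendsto_const]])
  also have "?p s0 * (D_coeff k s0 * (1 / 4) ^ k / 2) + tail_integral s0 * (s0 - s0) = 2 powr (- s0) * D_coeff k s0"
  proof -
    have "(1 / 4 :: complex) powr (2 * s0 - 2) = (1 / 4) powr (- of_nat k)"
      by (simp add: s0_def)
    also have "\<dots> = 1 / (1 / 4) ^ k"
      by (subst powr_minus) (simp add: field_simps)
    finally have "(1 / 4 :: complex) powr (2 * s0 - 2) * (1 / 4) ^ k = 1" by simp
    moreover have "(2 :: complex) powr (1 - s0) = 2 * 2 powr (- s0)"
      using powr_add[of "2 :: complex" 1 "- s0"] by simp
    ultimately show ?thesis by (simp add: mult_ac)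
  qed
  finally show ?thesis by (simp add: mellin_ext_def algebra_simps)
qed

section \<open>Values at the non-positive integers and residues at half-integers\<close>

lemma M_tendsto_imp:
  assumes "(M \<longlongrightarrow> c) (at z)"
  shows "\<not> is_pole M z \<and> M z = c"
proof -
  have "\<not> is_pole M z"
    using assms not_tendsto_and_filterlim_at_infinity[of "at z" M c] unfolding is_pole_def by auto
  moreover from this have "(M \<longlongrightarrow> M z) (at z)"
    using nicely_meromorphic_M unfolding nicely_meromorphic_on_def by auto
  ultimately show ?thesis using assms LIM_unique by blast
qed

text \<open>Here k = 2N + 2. The simple zero of \<open>rGamma\<close> at -N, with derivative (-1)^N
  N!, is paired with the residue 2^N D_k(-N) of \<open>mellin_ext\<close>.\<close>

lemma M_at_nonpos_int:
  "\<not> is_pole M (- of_nat N) \<and> M (- of_nat N) = (- 1) ^ N * fact N * 2 ^ N * D_coeff (2 * N + 2) (- of_nat N)"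
proof (rule M_tendsto_imp)
  let ?z = "- of_nat N :: complex"
  have z: "1 - of_nat (2 * N + 2) / 2 = ?z" by (simp add: field_simps)
  have "((\<lambda>s. rGamma s / (s - ?z)) \<longlongrightarrow> (- 1) ^ N * fact N) (at ?z)"
  proof -
    have "(rGamma has_field_derivative (- 1) ^ N * fact N) (at ?z)"
      by (rule has_field_derivative_rGamma_nonpos_int)
    thus ?thesis unfolding has_field_derivative_iff by simp
  qed
  moreover have "((\<lambda>s. mellin_ext s * (s - ?z)) \<longlongrightarrow> 2 powr (- ?z) * D_coeff (2 * N + 2) ?z) (at ?z)"
    using mellin_ext_residue[of "2 * N + 2"] unfolding z .
  ultimately have "((\<lambda>s. rGamma s / (s - ?z) * (mellin_ext s * (s - ?z))) \<longlongrightarrow>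
      (- 1) ^ N * fact N * (2 powr (- ?z) * D_coeff (2 * N + 2) ?z)) (at ?z)"
    by (rule tendsto_mult)
  moreover have "eventually (\<lambda>s. M s = rGamma s / (s - ?z) * (mellin_ext s * (s - ?z))) (at ?z)"
    using eventually_M_eq[of ?z] eventually_neq_at_within[of ?z]
  proof eventually_elim
    case (elim s)
    have "a / d * (b * d) = a * b" if "d \<noteq> 0" for a b d :: complex
      using that by simp
    moreover have "s - ?z \<noteq> 0" using elim(2) unfolding right_minus_eq .
    ultimately show ?case unfolding elim(1) by metis
  qed
  ultimately show "(M \<longlongrightarrow> (- 1) ^ N * fact N * 2 ^ N * D_coeff (2 * N + 2) ?z) (at ?z)"
    by (subst tendsto_cong) (simp_all add: mult.assoc)
qed

lemma M_residue_half_int: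
  "((\<lambda>s. M (s + 1 / 2) * (s + of_nat N)) \<longlongrightarrow>
     rGamma (1 / 2 - of_nat N) * 2 powr (of_nat N - 1 / 2) * D_coeff (2 * N + 1) (1 / 2 - of_nat N)) (at (- of_nat N))"
proof -
  let ?z = "1 / 2 - of_nat N :: complex"
  have z: "1 - of_nat (2 * N + 1) / 2 = ?z" by (simp add: field_simps)
  have "isCont rGamma ?z" by (intro continuous_intros)
  hence "(rGamma \<longlongrightarrow> rGamma ?z) (at ?z)" by (simp add: isCont_def)
  moreover have "((\<lambda>s. mellin_ext s * (s - ?z)) \<longlongrightarrow> 2 powr (- ?z) * D_coeff (2 * N + 1) ?z) (at ?z)"
    using mellin_ext_residue[of "2 * N + 1"] unfolding z .
  ultimately have "((\<lambda>s. rGamma s * (mellin_ext s * (s - ?z))) \<longlongrightarrow>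
      rGamma ?z * (2 powr (- ?z) * D_coeff (2 * N + 1) ?z)) (at ?z)"
    by (rule tendsto_mult)
  moreover have "eventually (\<lambda>s. M s * (s - ?z) = rGamma s * (mellin_ext s * (s - ?z))) (at ?z)"
    using eventually_M_eq[of ?z] by eventually_elim simp
  ultimately have "((\<lambda>s. M s * (s - ?z)) \<longlongrightarrow> rGamma ?z * (2 powr (- ?z) * D_coeff (2 * N + 1) ?z)) (at ?z)"
    by (subst tendsto_cong)
  \<comment> \<open>Translation by 1/2 moves the point 1/2 - N to -N.\<close>
  from LIM_offset[OF this, of "1 / 2"] show ?thesis by (simp add: mult.assoc add_ac)
qed

text \<open>Descends from 1/Gamma(1/2) = 1/sqrt(pi) by 1/Gamma(z) = z/Gamma(z + 1).\<close>

lemma rGamma_half_minus: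
  "rGamma (1 / 2 - of_nat N :: complex) = (- 1) ^ N * fact (2 * N) / (4 ^ N * fact N) / of_real (sqrt pi)"
proof (induction N)
  case 0
  show ?case by (simp add: rGamma_inverse_Gamma Gamma_one_half_complex inverse_eq_divide)
next
  case (Suc N)
  have "rGamma (1 / 2 - of_nat (Suc N) :: complex) = (1 / 2 - of_nat (Suc N)) * rGamma (1 / 2 - of_nat N)"
    using rGamma_plus1[of "1 / 2 - of_nat (Suc N) :: complex"] by (simp add: algebra_simps)
  also have "\<dots> = - ((2 * of_nat N + 1) / 2) * ((- 1) ^ N * fact (2 * N) / (4 ^ N * fact N) / of_real (sqrt pi))"
    unfolding Suc by (simp add: field_simps)
  also have "\<dots> = (- 1) ^ Suc N * fact (2 * Suc N) / (4 ^ Suc N * fact (Suc N)) / of_real (sqrt pi)"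
  proof -
    have "(fact (2 * Suc N) :: complex) = (2 * of_nat N + 2) * (2 * of_nat N + 1) * fact (2 * N)"
      by (simp add: algebra_simps)
    moreover have "(of_nat N + 1 :: complex) \<noteq> 0" by (metis of_nat_Suc add.commute of_nat_neq_0)
    ultimately show ?thesis by (simp add: divide_simps) (simp add: algebra_simps)
  qed
  finally show ?case .
qed

text \<open>With s = 1/2 - N and k = 2N + 1 one has 2s + k = 2 and 2s + k - 2 = 0. For N = 0 the
  index is 1, below the range of the recurrence, and both sides equal 2/3.\<close>

lemma D_coeff_odd: "(1 - 2 * of_nat N) * D_coeff (2 * N + 1) (1 / 2 - of_nat N) = 2 * A (2 * N + 1) (1 / 2 - of_nat N)"
proof (cases N)
  case 0
  thus ?thesis by (simp add: D_coeff_conv_A A_0 A_1[unfolded One_nat_def])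
next
  case (Suc m)
  have k: "2 * N + 1 = Suc (Suc (2 * m + 1))" by (simp add: Suc)
  have coeffs: "2 * (1 / 2 - of_nat N) + of_nat (2 * m + 1) + 2 = (2 :: complex)"
    "2 * (1 / 2 - of_nat N) + of_nat (2 * m + 1) = (0 :: complex)"
    "2 * (1 / 2 - of_nat N) = (1 - 2 * of_nat N :: complex)"
    by (simp_all add: Suc algebra_simps)
  show ?thesis
    using D_coeff_Suc_Suc[of "1 / 2 - of_nat N" "2 * m + 1"] unfolding k[symmetric] coeffs(1,2) unfolding coeffs(3) by simp
qed

text \<open>Poles are excluded explicitly because \<open>M\<close> takes the value 0 at a pole, so a
  bare equation would not certify regularity. In the limit, \<open>powi\<close> accommodates the
  exponent -1 at N = 0.\<close>

theorem theorem1p2: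
  fixes N :: nat
  shows "(\<not> is_pole M 0 \<and> M 0 = deriv (A 2) 0 - A 0 0 \<and> deriv (A 2) 0 - A 0 0 = - 13 / 18)
    \<and> (N > 0 \<longrightarrow> \<not> is_pole M (- of_nat N) \<and>
         M (- of_nat N) =
           (- 1) ^ (N - 1) * 2 ^ N * fact (N - 1) * A (2 * N + 2) (- of_nat N))
    \<and> ((\<lambda>s. M (s + 1 / 2) * (s + of_nat N)) \<longlongrightarrow>
         (- 1) powi (int N - 1) * (fact (2 * N) / (2 ^ N * fact N))
           * (A (2 * N + 1) (1 / 2 - of_nat N) / (2 * of_nat N - 1))
           * complex_of_real (sqrt (2 / pi))) (at (- of_nat N))"
proof (intro conjI impI)
  have A2: "A 2 = (\<lambda>s. s * (4 * s + 5) / 18)" by (rule ext) (rule A_2)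
  have "(A 2 has_field_derivative 5 / 18) (at 0)"
    unfolding A2 by (auto intro!: derivative_eq_intros)
  hence deriv: "deriv (A 2) 0 = 5 / 18" by (rule DERIV_imp_deriv)
  show val: "deriv (A 2) 0 - A 0 0 = - 13 / 18" by (simp add: deriv A_0)
  show "\<not> is_pole M 0" using M_at_nonpos_int[of 0] by simp
  \<comment> \<open>The recurrence degenerates at s = 0, so D_2(0) = A_2(-1) + A_1(-1) = -1/18 -
    12/18 is computed directly.\<close>
  have "D_coeff 2 0 = - 13 / 18" by (simp add: D_coeff_conv_A A_2 A_1[unfolded One_nat_def])
  moreover have "M 0 = D_coeff 2 0" using M_at_nonpos_int[of 0] by (simp add: numeral_2_eq_2)
  ultimately show "M 0 = deriv (A 2) 0 - A 0 0" using val by metis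
next
  assume N: "N > 0"
  then obtain m where m: "N = Suc m" using gr0_implies_Suc by blast
  show "\<not> is_pole M (- of_nat N)" using M_at_nonpos_int[of N] by simp
  \<comment> \<open>At s = -N the coefficient 2s + 2N of A_(2N)(-N) vanishes.\<close>
  have *: "- (2 * of_nat N) * D_coeff (2 * N + 2) (- of_nat N) = 2 * A (2 * N + 2) (- of_nat N)"
    using D_coeff_Suc_Suc[of "- of_nat N" "2 * N"] by simp
  have D_coeff: "of_nat N * D_coeff (2 * N + 2) (- of_nat N) = - A (2 * N + 2) (- of_nat N)"
  proof -
    have "n * d = - a" if "- (2 * n) * d = 2 * a" for n d a :: complex
    proof -
      have "2 * (n * d + a) = 2 * a - - (2 * n) * d" by (simp add: algebra_simps)
      also have "\<dots> = 0" unfolding that by simp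
      finally have "n * d + a = 0" unfolding mult_eq_0_iff by simp
      thus ?thesis by (simp add: eq_neg_iff_add_eq_0)
    qed
    from this[OF * ] show ?thesis .
  qed
  \<comment> \<open>The recurrence determines only N times the coefficient; this N is taken from N!,
    which leaves (N - 1)!.\<close>
  have "fact N = of_nat N * (fact (N - 1) :: complex)" using N by (rule fact_reduce)
  hence "M (- of_nat N) = (- 1) ^ N * 2 ^ N * fact (N - 1) * (of_nat N * D_coeff (2 * N + 2) (- of_nat N))"
    using M_at_nonpos_int[of N] by (simp add: mult_ac)
  thus "M (- of_nat N) = (- 1) ^ (N - 1) * 2 ^ N * fact (N - 1) * A (2 * N + 2) (- of_nat N)"
    unfolding D_coeff by (simp add: m)
next
  let ?z = "1 / 2 - of_nat N :: complex"
  have nz: "(2 * of_nat N - 1 :: complex) \<noteq> 0" "(1 - 2 * of_nat N :: complex) \<noteq> 0"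
  proof -
    have "(of_nat (2 * N) :: complex) \<noteq> of_nat 1"
      unfolding of_nat_eq_iff by presburger
    thus "(2 * of_nat N - 1 :: complex) \<noteq> 0" "(1 - 2 * of_nat N :: complex) \<noteq> 0"
      by auto
  qed
  have D_coeff: "D_coeff (2 * N + 1) ?z = - (2 * (A (2 * N + 1) ?z / (2 * of_nat N - 1)))"
    using D_coeff_odd[of N] nz by (simp add: field_simps)
  have sgn: "(- 1 :: complex) powi (int N - 1) = - ((- 1) ^ N)"
    by (simp add: power_int_diff)
  \<comment> \<open>The extra factor 2 comes from \<open>D_coeff\<close>. The resulting 2^N cancels
    half of the 4^N in \<open>rGamma_half_minus\<close>, and sqrt 2 combines with
    1/sqrt(pi).\<close>
  have p: "(2 :: complex) powr (of_nat N - 1 / 2) * 2 = 2 ^ N * of_real (sqrt 2)"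
  proof -
    have "(2 :: complex) powr (of_nat N - 1 / 2) * 2 = 2 powr (of_nat N + 1 / 2)"
      using powr_add[of "2 :: complex" "of_nat N - 1 / 2" 1] by (simp add: add.commute)
    also have "\<dots> = 2 ^ N * 2 powr (1 / 2)" by (simp add: powr_add)
    also have "(2 :: complex) powr (1 / 2) = of_real (sqrt 2)"
      using powr_of_real[of 2 "1 / 2"] by (simp add: powr_half_sqrt)
    finally show ?thesis .
  qed
  have "rGamma ?z * 2 powr (of_nat N - 1 / 2) * D_coeff (2 * N + 1) ?z =
      - rGamma ?z * (2 powr (of_nat N - 1 / 2) * 2) * (A (2 * N + 1) ?z / (2 * of_nat N - 1))"
    unfolding D_coeff by simp
  also have "- rGamma ?z * (2 powr (of_nat N - 1 / 2) * 2) =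
      (- 1) powi (int N - 1) * (fact (2 * N) / (2 ^ N * fact N)) * of_real (sqrt (2 / pi))"
  proof -
    have "(4 :: complex) ^ N = 2 ^ N * 2 ^ N" by (simp flip: power_mult_distrib)
    thus ?thesis unfolding p sgn rGamma_half_minus by (simp add: real_sqrt_divide field_simps)
  qed
  finally show "((\<lambda>s. M (s + 1 / 2) * (s + of_nat N)) \<longlongrightarrow>
         (- 1) powi (int N - 1) * (fact (2 * N) / (2 ^ N * fact N))
           * (A (2 * N + 1) (1 / 2 - of_nat N) / (2 * of_nat N - 1))
           * complex_of_real (sqrt (2 / pi))) (at (- of_nat N))"
    using M_residue_half_int[of N] by (simp add: mult_ac)
qed

end
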